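(* Let $\mathbb{F}$ be a finite field of characteristic $2$ with at least $4$ elements, and let $n\geq 1$. Then every matrix $A\in M_n(\mathbb{F})$ can be written as $A=N+D$ with $N,D\in M_n(\mathbb{F})$, $N^2=0$, and $D$ diagonalizable.
   Context: A matrix $D\in M_n(\mathbb{F})$ is diagonalizable if there exists an invertible $U\in M_n(\mathbb{F})$ such that $U^{-1}DU$ is diagonal. *)

theory Defs
  imports "HOL-Analysis.Analysis"
begin

text \<open>A square matrix is diagonal if all off-diagonal entries vanish.\<close>
definition is_diagonal_matrix :: "'a::zero ^'n^'n \<Rightarrow> bool" where
  "is_diagonal_matrix A \<longleftrightarrow> (\<forall>i j. i \<noteq> j \<longrightarrow> A $ i $ j = 0)"

text \<open>D is diagonalizable if U^{-1} D U is diagonal for some invertible U.\<close>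
definition diagonalizable :: "'a::field ^'n^'n \<Rightarrow> bool" where
  "diagonalizable D \<longleftrightarrow>
     (\<exists>U::'a^'n^'n. invertible U \<and> is_diagonal_matrix (matrix_inv U ** D ** U))"

end

theory Submission
  imports Defs "HOL-Computational_Algebra.Polynomial"
begin

text \<open>
  Split \<open>F\<^sup>n\<close> into \<open>A\<close>-invariant cyclic subspaces and treat the blocks one at a time; linear
  maps on the blocks glue along the direct sum. A cyclic summand of an invariant subspace \<open>W\<close> is
  generated by a vector that is Hankel-normalized for a functional \<open>\<psi>\<close> whose sequences \<open>\<psi> (A\<^sup>i x)\<close>,
  \<open>x \<in> W\<close>, obey no common linear recurrence of order below the largest possible \<open>k\<close>; the common
  kernel of the \<open>\<psi> \<circ> A\<^sup>i\<close>, \<open>i < k\<close>, is an invariant complement.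

  On a cyclic block take the Newton basis \<open>v\<^sub>j = (A - a\<^sub>0) \<cdots> (A - a\<^sub>j\<^sub>-\<^sub>1) w\<close>, so that
  \<open>A v\<^sub>j = a\<^sub>j v\<^sub>j + v\<^sub>j\<^sub>+\<^sub>1\<close>. Counting from the end of the basis, \<open>D\<close> keeps the vectors at even
  distance as eigenvectors and agrees with \<open>A\<close> on those at odd distance. Then \<open>N = A - D\<close> maps
  everything into the span of the odd vectors and kills them, so \<open>N\<^sup>2 = 0\<close>, and the nodes \<open>a\<^sub>j\<close>
  can be chosen, using \<open>\<bar>F\<bar> \<ge> 4\<close> and characteristic two, to make \<open>D\<close> diagonalizable. The one
  block where no choice works, \<open>A\<^sup>2 = c\<close> on a plane, takes \<open>D = \<surd>c\<close>: in characteristic two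
  square roots exist and \<open>(A - \<surd>c)\<^sup>2 = A\<^sup>2 - c = 0\<close>.
\<close>

section \<open>Polynomials applied to linear maps\<close>

lemma linear_funpow:
  fixes f :: "'a::field^'n \<Rightarrow> 'a^'n"
  assumes "Vector_Spaces.linear (*s) (*s) f"
  shows "Vector_Spaces.linear (*s) (*s) (f ^^ k)"
proof (induction k)
  case 0
  then show ?case using vec.linear_id by (simp add: id_def)
next
  case (Suc k)
  then show ?case using Vector_Spaces.linear_compose[OF Suc.IH assms] by (simp add: comp_def)
qed

definition poly_map :: "('a::field^'n \<Rightarrow> 'a^'n) \<Rightarrow> 'a poly \<Rightarrow> 'a^'n \<Rightarrow> 'a^'n" where
  "poly_map f p x = (\<Sum>i\<le>degree p. coeff p i *s (f ^^ i) x)"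

lemma poly_map_eq_sum:
  assumes "\<forall>i\<ge>N. coeff p i = 0"
  shows "poly_map f p x = (\<Sum>i<N. coeff p i *s (f ^^ i) x)"
proof -
  have "degree p < N \<or> p = 0"
    using assms by (metis leading_coeff_0_iff not_le)
  then show ?thesis
    unfolding poly_map_def
    by (elim disjE, intro sum.mono_neutral_left) (auto simp: coeff_eq_0)
qed

lemma poly_map_0 [simp]: "poly_map f 0 x = 0"
  by (simp add: poly_map_def)

lemma poly_map_const: "poly_map f [:c:] x = c *s x"
  by (simp add: poly_map_def)

lemma poly_map_1: "poly_map f 1 x = x"
  by (simp add: poly_map_def)

lemma poly_map_add: "poly_map f (p + q) x = poly_map f p x + poly_map f q x"
proof -
  define N where "N = Suc (max (degree p) (degree q))"
  have "\<forall>i\<ge>N. coeff (p + q) i = 0" "\<forall>i\<ge>N. coeff p i = 0" "\<forall>i\<ge>N. coeff q i = 0"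
    using degree_add_le_max[of p q] by (auto simp: N_def coeff_eq_0)
  then show ?thesis
    by (simp add: poly_map_eq_sum[where N=N] sum.distrib vector_sadd_rdistrib)
qed

lemma poly_map_smult: "poly_map f (smult c p) x = c *s poly_map f p x"
proof -
  have "\<forall>i\<ge>Suc (degree p). coeff (smult c p) i = 0" "\<forall>i\<ge>Suc (degree p). coeff p i = 0"
    by (auto simp: coeff_eq_0)
  then show ?thesis
    by (simp add: poly_map_eq_sum[where N="Suc (degree p)"] vec.scale_sum_right vector_smult_assoc)
qed

lemma poly_map_minus: "poly_map f (- p) x = - poly_map f p x"
  using poly_map_smult[of f "-1" p x] by (simp add: vector_smult_lneg)

lemma poly_map_diff: "poly_map f (p - q) x = poly_map f p x - poly_map f q x"
  using poly_map_add[of f p "- q" x] by (simp add: poly_map_minus)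

lemma poly_map_sum: "poly_map f (sum g S) x = (\<Sum>i\<in>S. poly_map f (g i) x)"
  by (induction S rule: infinite_finite_induct) (auto simp: poly_map_add)

lemma poly_map_monom: "poly_map f (monom c i) x = c *s (f ^^ i) x"
  by (simp add: poly_map_eq_sum[where N="Suc i"] coeff_monom if_distrib[where f="\<lambda>c. c *s _"]
      cong: if_cong)

context
  fixes f :: "'a::field^'n \<Rightarrow> 'a^'n"
  assumes f: "Vector_Spaces.linear (*s) (*s) f"
begin

lemma linear_poly_map: "Vector_Spaces.linear (*s) (*s) (poly_map f p)"
  unfolding poly_map_def
  by (intro vec.linear_compose_sum ballI vec.linear_compose_scale_right linear_funpow[OF f])

lemma poly_map_pCons_0: "poly_map f (pCons 0 p) x = f (poly_map f p x)"
proof -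
  define N where "N = Suc (degree p)"
  have hi: "\<forall>i\<ge>N. coeff p i = 0" "\<forall>i\<ge>Suc N. coeff (pCons 0 p) i = 0"
    by (auto simp: N_def coeff_eq_0 coeff_pCons split: nat.split)
  have "poly_map f (pCons 0 p) x = (\<Sum>i<N. coeff p i *s (f ^^ Suc i) x)"
    unfolding poly_map_eq_sum[OF hi(2)] sum.lessThan_Suc_shift by simp
  also have "\<dots> = f (poly_map f p x)"
    by (simp add: poly_map_eq_sum[OF hi(1)] vec.linear_sum[OF f] vec.linear_scale[OF f])
  finally show ?thesis .
qed

lemma poly_map_pCons: "poly_map f (pCons a p) x = a *s x + f (poly_map f p x)"
proof -
  have "pCons a p = [:a:] + pCons 0 p" by simp
  then show ?thesis by (simp only: poly_map_add poly_map_const poly_map_pCons_0)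
qed

lemma poly_map_linear_factor: "poly_map f [:- a, 1:] x = f x - a *s x"
  by (simp add: poly_map_pCons vec.linear_0[OF f] vector_smult_lneg)

lemma poly_map_mult: "poly_map f (p * q) x = poly_map f p (poly_map f q x)"
proof (induction p)
  case 0
  then show ?case by (simp add: vec.linear_0[OF linear_poly_map])
next
  case (pCons a p)
  have "pCons a p * q = smult a q + pCons 0 (p * q)" by simp
  then show ?case
    by (simp add: poly_map_add poly_map_smult poly_map_pCons_0 poly_map_pCons pCons.IH)
qed

end

section \<open>Linear functionals\<close>

interpretation vec_functional:
  vector_space_pair "(*s) :: 'a::field \<Rightarrow> 'a^'n \<Rightarrow> 'a^'n" "(*) :: 'a \<Rightarrow> 'a \<Rightarrow> 'a" ..

lemma functional_vanishing_on_common_kernel: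
  fixes \<psi> :: "nat \<Rightarrow> 'a::field^'n \<Rightarrow> 'a"
  assumes W: "vec.subspace W" and lin: "\<And>i. Vector_Spaces.linear (*s) (*) (\<psi> i)"
    and lin_\<phi>: "Vector_Spaces.linear (*s) (*) \<phi>"
    and e: "\<And>j. e j \<in> W" "\<And>i j. i < k \<Longrightarrow> \<psi> i (e j) = (if i = j then 1 else 0)"
    and vanish: "\<And>y. y \<in> W \<Longrightarrow> \<forall>i<k. \<psi> i y = 0 \<Longrightarrow> \<phi> y = 0"
    and x: "x \<in> W"
  shows "\<phi> x = (\<Sum>j<k. \<psi> j x * \<phi> (e j))"
proof -
  define y where "y = x - (\<Sum>j<k. \<psi> j x *s e j)"
  have "y \<in> W"
    unfolding y_def using x e(1) W
    by (intro vec.subspace_diff vec.subspace_sum vec.subspace_scale) auto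
  moreover have "\<psi> i y = 0" if "i < k" for i
  proof -
    have "(\<Sum>j<k. \<psi> j x * \<psi> i (e j)) = \<psi> i x"
      using that by (simp add: e(2) if_distrib[where f="(*) _"] cong: if_cong)
    then show ?thesis
      by (simp add: y_def vec_functional.linear_diff[OF lin] vec_functional.linear_sum[OF lin]
          vec_functional.linear_scale[OF lin])
  qed
  ultimately have "\<phi> y = 0" using vanish by blast
  then show ?thesis
    by (simp add: y_def vec_functional.linear_diff[OF lin_\<phi>] vec_functional.linear_sum[OF lin_\<phi>]
        vec_functional.linear_scale[OF lin_\<phi>])
qed

lemma independent_functionals_interpolate:
  fixes \<psi> :: "nat \<Rightarrow> 'a::field^'n \<Rightarrow> 'a"
  assumes W: "vec.subspace W" and lin: "\<And>i. Vector_Spaces.linear (*s) (*) (\<psi> i)"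
    and indep: "\<And>c. \<forall>x\<in>W. (\<Sum>i<k. c i * \<psi> i x) = 0 \<Longrightarrow> \<forall>i<k. c i = 0"
  shows "\<exists>x\<in>W. \<forall>i<k. \<psi> i x = t i"
  using indep
proof (induction k arbitrary: t)
  case 0
  then show ?case using W vec.subspace_0 by blast
next
  case (Suc k)
  note lin_simps = vec_functional.linear_add[OF lin] vec_functional.linear_diff[OF lin]
    vec_functional.linear_scale[OF lin]
  have indep_k: "\<forall>i<k. c i = 0" if "\<forall>x\<in>W. (\<Sum>i<k. c i * \<psi> i x) = 0" for c
  proof -
    have "\<forall>x\<in>W. (\<Sum>i<Suc k. (c(k := 0)) i * \<psi> i x) = 0"
      using that by simp
    then have "\<forall>i<Suc k. (c(k := 0)) i = 0" by (rule Suc.prems)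
    then show ?thesis by (metis fun_upd_other less_SucI nat_neq_iff)
  qed
  note IH = Suc.IH[OF indep_k]
  obtain e where e: "\<And>j. e j \<in> W" "\<And>i j. i < k \<Longrightarrow> \<psi> i (e j) = (if i = j then 1 else 0)"
    using IH[of "\<lambda>i. if i = _ then 1 else 0"] by metis
  have "\<exists>y\<in>W. (\<forall>i<k. \<psi> i y = 0) \<and> \<psi> k y = 1"
  proof (rule ccontr)
    assume none: "\<not> ?thesis"
    have vanish: "\<psi> k y = 0" if y: "y \<in> W" "\<forall>i<k. \<psi> i y = 0" for y
    proof (rule ccontr)
      assume "\<psi> k y \<noteq> 0"
      then have "inverse (\<psi> k y) *s y \<in> W \<and> (\<forall>i<k. \<psi> i (inverse (\<psi> k y) *s y) = 0)
          \<and> \<psi> k (inverse (\<psi> k y) *s y) = 1"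
        using y W vec.subspace_scale by (auto simp: lin_simps)
      then show False using none by blast
    qed
    have "\<psi> k x = (\<Sum>j<k. \<psi> j x * \<psi> k (e j))" if "x \<in> W" for x
      using functional_vanishing_on_common_kernel[OF W lin lin[of k] e vanish that] .
    then have "\<forall>x\<in>W. (\<Sum>i<Suc k. (if i < k then \<psi> k (e i) else -1) * \<psi> i x) = 0"
      by (simp add: mult.commute)
    then have "\<forall>i<Suc k. (if i < k then \<psi> k (e i) else -1) = 0" by (rule Suc.prems)
    then show False by (auto dest: spec[of _ k])
  qed
  then obtain y where y: "y \<in> W" "\<And>i. i < k \<Longrightarrow> \<psi> i y = 0" "\<psi> k y = 1" by blast
  obtain x where x: "x \<in> W" "\<And>i. i < k \<Longrightarrow> \<psi> i x = t i" using IH by blast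
  have "x + (t k - \<psi> k x) *s y \<in> W"
    using x y W by (intro vec.subspace_add vec.subspace_scale) auto
  moreover have "\<psi> i (x + (t k - \<psi> k x) *s y) = t i" if "i < Suc k" for i
    using that x y by (cases "i = k") (auto simp: lin_simps)
  ultimately show ?case by blast
qed

lemma independent_if_coefficients_vanish:
  fixes u :: "nat \<Rightarrow> 'a::field^'n"
  assumes indep: "\<And>c. (\<Sum>j<k. c j *s u j) = 0 \<Longrightarrow> \<forall>j<k. c j = 0"
  shows "inj_on u {..<k}" and "vec.independent (u ` {..<k})"
proof -
  show inj: "inj_on u {..<k}"
  proof (rule inj_onI, rule ccontr)
    fix i j assume ij: "i \<in> {..<k}" "j \<in> {..<k}" "u i = u j" "i \<noteq> j"
    define c where "c l = (if l = i then 1 else if l = j then -1 else (0::'a))" for l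
    have "(\<Sum>l<k. c l *s u l) = (\<Sum>l<k. (if l = i then u i else 0) - (if l = j then u j else 0))"
      by (intro sum.cong) (auto simp: c_def \<open>i \<noteq> j\<close> vector_smult_lneg)
    also have "\<dots> = 0" using ij by (simp add: sum_subtractf)
    finally show False using indep[of c] ij by (auto simp: c_def)
  qed
  show "vec.independent (u ` {..<k})"
  proof (rule vec.independent_if_scalars_zero)
    fix f x assume "(\<Sum>x\<in>u ` {..<k}. f x *s x) = 0" and x: "x \<in> u ` {..<k}"
    then have "(\<Sum>j<k. f (u j) *s u j) = 0" by (simp add: sum.reindex[OF inj])
    then show "f x = 0" using indep[of "\<lambda>j. f (u j)"] x by auto
  qed simp
qed

lemma functional_interpolates_independent:
  fixes u :: "nat \<Rightarrow> 'a::field^'n"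
  assumes "\<And>c. (\<Sum>j<k. c j *s u j) = 0 \<Longrightarrow> \<forall>j<k. c j = 0"
  shows "\<exists>\<psi>. Vector_Spaces.linear (*s) (*) \<psi> \<and> (\<forall>i<k. \<psi> (u i) = t i)"
proof -
  have indep: "inj_on u {..<k}" "vec.independent (u ` {..<k})"
    using independent_if_coefficients_vanish[where u=u and k=k] assms by blast+
  obtain \<psi> where "Vector_Spaces.linear (*s) (*) \<psi>"
    and "\<forall>x\<in>u ` {..<k}. \<psi> x = t (the_inv_into {..<k} u x)"
    using vec_functional.linear_independent_extend[OF indep(2),
        where f="\<lambda>x. t (the_inv_into {..<k} u x)"] by blast
  then show ?thesis using indep(1) by (auto simp: the_inv_into_f_f)
qed

section \<open>Cyclic subspaces\<close>

definition mpow :: "'a::field^'n^'n \<Rightarrow> nat \<Rightarrow> 'a^'n \<Rightarrow> 'a^'n" where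
  "mpow A i = ((*v) A ^^ i)"

lemma mpow_0 [simp]: "mpow A 0 x = x"
  by (simp add: mpow_def)

lemma mpow_Suc: "mpow A (Suc i) x = A *v mpow A i x"
  by (simp add: mpow_def)

lemma mpow_mpow: "mpow A i (mpow A j x) = mpow A (i + j) x"
  by (simp add: mpow_def funpow_add)

lemma mpow_Suc_right: "mpow A (Suc i) x = mpow A i (A *v x)"
  using mpow_mpow[of A i 1 x] by (simp add: mpow_def)

lemma linear_mpow: "Vector_Spaces.linear (*s) (*s) (mpow A i)"
  unfolding mpow_def by (rule linear_funpow[OF matrix_vector_mul_linear_gen])

definition invariant_subspace :: "'a::field^'n^'n \<Rightarrow> ('a^'n) set \<Rightarrow> bool" where
  "invariant_subspace A W \<longleftrightarrow> vec.subspace W \<and> (\<forall>x\<in>W. A *v x \<in> W)"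

lemma mpow_in_invariant_subspace: "invariant_subspace A W \<Longrightarrow> x \<in> W \<Longrightarrow> mpow A i x \<in> W"
  by (induction i) (auto simp: mpow_Suc invariant_subspace_def)

definition krylov_indep :: "'a::field^'n^'n \<Rightarrow> 'a^'n \<Rightarrow> nat \<Rightarrow> bool" where
  "krylov_indep A w k \<longleftrightarrow> (\<forall>c. (\<Sum>j<k. c j *s mpow A j w) = 0 \<longrightarrow> (\<forall>j<k. c j = 0))"

definition cyclic_subspace :: "'a::field^'n^'n \<Rightarrow> 'a^'n \<Rightarrow> nat \<Rightarrow> ('a^'n) set" where
  "cyclic_subspace A w k = {\<Sum>j<k. c j *s mpow A j w | c. True}"

lemma subspace_cyclic_subspace: "vec.subspace (cyclic_subspace A w k)"
  unfolding vec.subspace_def cyclic_subspace_def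
proof (intro conjI ballI allI)
  show "0 \<in> {\<Sum>j<k. c j *s mpow A j w |c. True}"
    unfolding mem_Collect_eq by (intro exI[of _ "\<lambda>_. 0"]) simp
next
  fix x y assume "x \<in> {\<Sum>j<k. c j *s mpow A j w |c. True}" "y \<in> {\<Sum>j<k. c j *s mpow A j w |c. True}"
  then obtain c d where "x = (\<Sum>j<k. c j *s mpow A j w)" "y = (\<Sum>j<k. d j *s mpow A j w)"
    by blast
  then show "x + y \<in> {\<Sum>j<k. c j *s mpow A j w |c. True}"
    unfolding mem_Collect_eq
    by (intro exI[of _ "\<lambda>j. c j + d j"]) (simp add: sum.distrib vector_sadd_rdistrib)
next
  fix r x assume "x \<in> {\<Sum>j<k. c j *s mpow A j w |c. True}"
  then obtain c where "x = (\<Sum>j<k. c j *s mpow A j w)" by blast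
  then show "r *s x \<in> {\<Sum>j<k. c j *s mpow A j w |c. True}"
    unfolding mem_Collect_eq
    by (intro exI[of _ "\<lambda>j. r * c j"]) (simp add: vec.scale_sum_right vector_smult_assoc)
qed

lemma mpow_in_cyclic_subspace:
  assumes "i < k"
  shows "mpow A i w \<in> cyclic_subspace A w k"
proof -
  have "mpow A i w = (\<Sum>j<k. (if j = i then 1 else 0) *s mpow A j w)"
    using assms by (simp add: if_distrib[where f="\<lambda>a. a *s _"] cong: if_cong)
  then show ?thesis
    unfolding cyclic_subspace_def mem_Collect_eq
    by (intro exI[of _ "\<lambda>j. if j = i then 1 else 0"]) simp
qed

lemma invariant_cyclic_subspace:
  assumes "mpow A k w \<in> cyclic_subspace A w k"
  shows "invariant_subspace A (cyclic_subspace A w k)"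
  unfolding invariant_subspace_def
proof (intro conjI ballI subspace_cyclic_subspace)
  fix x assume "x \<in> cyclic_subspace A w k"
  then obtain c where "x = (\<Sum>j<k. c j *s mpow A j w)" by (auto simp: cyclic_subspace_def)
  then have "A *v x = (\<Sum>j<k. c j *s mpow A (Suc j) w)"
    by (simp add: vec.linear_sum[OF matrix_vector_mul_linear_gen] mpow_Suc
        vec.linear_scale[OF matrix_vector_mul_linear_gen])
  also have "\<dots> \<in> cyclic_subspace A w k"
  proof (intro vec.subspace_sum vec.subspace_scale subspace_cyclic_subspace)
    fix j assume "j \<in> {..<k}"
    then show "mpow A (Suc j) w \<in> cyclic_subspace A w k"
      using assms mpow_in_cyclic_subspace[of "Suc j" k] by (cases "Suc j = k") auto
  qed
  finally show "A *v x \<in> cyclic_subspace A w k" .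
qed

lemma cyclic_subspace_subset:
  assumes "invariant_subspace A W" "w \<in> W"
  shows "cyclic_subspace A w k \<subseteq> W"
  using assms mpow_in_invariant_subspace[OF assms]
  by (auto simp: cyclic_subspace_def invariant_subspace_def
      intro!: vec.subspace_sum vec.subspace_scale)

lemma krylov_indep_Suc:
  assumes indep: "krylov_indep A w k" and new: "mpow A k w \<notin> cyclic_subspace A w k"
  shows "krylov_indep A w (Suc k)"
  unfolding krylov_indep_def
proof (rule allI, rule impI)
  fix c assume c: "(\<Sum>j<Suc k. c j *s mpow A j w) = 0"
  have "c k = 0"
  proof (rule ccontr)
    assume ck: "c k \<noteq> 0"
    have c1: "c k *s mpow A k w = - (\<Sum>j<k. c j *s mpow A j w)"
      using c by (simp add: eq_neg_iff_add_eq_0 add.commute)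
    have "mpow A k w = (\<Sum>j<k. (- c j / c k) *s mpow A j w)"
    proof -
      have "mpow A k w = inverse (c k) *s (c k *s mpow A k w)"
        using ck by (simp add: vector_smult_assoc)
      also have "\<dots> = (\<Sum>j<k. (- c j / c k) *s mpow A j w)"
        unfolding c1 by (simp add: vec.scale_sum_right vector_smult_assoc vector_smult_rneg
            vector_smult_lneg sum_negf divide_inverse mult.commute)
      finally show ?thesis .
    qed
    then have "mpow A k w \<in> cyclic_subspace A w k"
      unfolding cyclic_subspace_def mem_Collect_eq by (intro exI[of _ "\<lambda>j. - c j / c k"]) simp
    then show False using new by blast
  qed
  then show "\<forall>j<Suc k. c j = 0"
    using c indep by (auto simp: krylov_indep_def less_Suc_eq)
qed

section \<open>Splitting off a cyclic summand\<close>

definition has_recurrence :: "'a::field^'n^'n \<Rightarrow> ('a^'n) set \<Rightarrow> ('a^'n \<Rightarrow> 'a) \<Rightarrow> nat \<Rightarrow> bool" where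
  "has_recurrence A W \<psi> m \<longleftrightarrow>
     (\<exists>c. \<forall>x\<in>W. \<psi> (mpow A m x) = (\<Sum>i<m. c i * \<psi> (mpow A i x)))"

lemma has_recurrence_exists:
  fixes A :: "'a::{field,finite}^'n^'n"
  shows "\<exists>m. has_recurrence A W \<psi> m"
proof -
  have "\<not> inj (mpow A)"
    using finite_imageD[of "mpow A" UNIV] by (auto intro: finite_subset[OF subset_UNIV])
  then obtain i j where ij: "i < j" "mpow A i = mpow A j"
    unfolding inj_def by (metis linorder_neqE_nat)
  have "\<psi> (mpow A j x) = (\<Sum>l<j. (if l = i then 1 else 0) * \<psi> (mpow A l x))" for x
    using ij by (simp add: if_distrib[where f="\<lambda>a. a * _"] cong: if_cong)
  then have "has_recurrence A W \<psi> j"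
    unfolding has_recurrence_def by (intro exI[of _ "\<lambda>l. if l = i then 1 else 0"]) simp
  then show ?thesis by blast
qed

lemma last_nonzero_index:
  fixes c :: "nat \<Rightarrow> 'a::zero"
  assumes "\<not> (\<forall>j<k. c j = 0)"
  shows "\<exists>m<k. c m \<noteq> 0 \<and> (\<forall>j. m < j \<and> j < k \<longrightarrow> c j = 0)"
  using assms
proof (induction k)
  case 0
  then show ?case by simp
next
  case (Suc k)
  show ?case
  proof (cases "c k = 0")
    case True
    then obtain m where "m < k" "c m \<noteq> 0" "\<forall>j. m < j \<and> j < k \<longrightarrow> c j = 0"
      using Suc by (metis less_Suc_eq)
    then show ?thesis using True by (intro exI[of _ m]) (auto simp: less_Suc_eq)
  qed auto
qed

lemma functionals_independent_if_no_recurrence: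
  assumes no_rec: "\<And>m. m < k \<Longrightarrow> \<not> has_recurrence A W \<psi> m"
    and zero: "\<forall>x\<in>W. (\<Sum>i<k. c i * \<psi> (mpow A i x)) = 0"
  shows "\<forall>i<k. c i = 0"
proof (rule ccontr)
  assume "\<not> ?thesis"
  then obtain m where m: "m < k" "c m \<noteq> 0" and above: "\<forall>j. m < j \<and> j < k \<longrightarrow> c j = 0"
    using last_nonzero_index by blast
  have "\<psi> (mpow A m x) = (\<Sum>i<m. (- c i / c m) * \<psi> (mpow A i x))" if x: "x \<in> W" for x
  proof -
    have "(\<Sum>i<k. c i * \<psi> (mpow A i x)) = (\<Sum>i<Suc m. c i * \<psi> (mpow A i x))"
      by (rule sum.mono_neutral_right) (use m above in auto)
    then have cm: "c m * \<psi> (mpow A m x) = - (\<Sum>i<m. c i * \<psi> (mpow A i x))"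
      using zero x by (simp add: eq_neg_iff_add_eq_0 add.commute)
    have "\<psi> (mpow A m x) = c m * \<psi> (mpow A m x) / c m"
      using m(2) by simp
    then have "\<psi> (mpow A m x) = - (\<Sum>i<m. c i * \<psi> (mpow A i x)) / c m"
      unfolding cm .
    then show ?thesis by (simp add: sum_divide_distrib sum_negf)
  qed
  then have "has_recurrence A W \<psi> m"
    unfolding has_recurrence_def by (intro exI[of _ "\<lambda>i. - c i / c m"]) simp
  then show False using no_rec m(1) by blast
qed

text \<open>For a Hankel-normalized \<open>w\<close> the Hankel matrix \<open>(\<psi> (A\<^sup>i\<^sup>+\<^sup>j w))\<^sub>i\<^sub>,\<^sub>j\<^sub><\<^sub>k\<close> is
  anti-triangular with ones on the anti-diagonal, hence invertible.\<close>

definition hankel_normalized :: "'a::field^'n^'n \<Rightarrow> ('a^'n \<Rightarrow> 'a) \<Rightarrow> 'a^'n \<Rightarrow> nat \<Rightarrow> bool" where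
  "hankel_normalized A \<psi> w k \<longleftrightarrow> (\<forall>m<k. \<psi> (mpow A m w) = (if m = k - 1 then 1 else 0))"

definition hankel_kernel :: "'a::field^'n^'n \<Rightarrow> ('a^'n) set \<Rightarrow> ('a^'n \<Rightarrow> 'a) \<Rightarrow> nat \<Rightarrow> ('a^'n) set"
  where "hankel_kernel A W \<psi> k = {x \<in> W. \<forall>i<k. \<psi> (mpow A i x) = 0}"

context
  fixes \<psi> :: "'a::field^'n \<Rightarrow> 'a"
  assumes lin: "Vector_Spaces.linear (*s) (*) \<psi>"
begin

lemma functional_mpow_krylov_sum:
  "\<psi> (mpow A i (\<Sum>j<k. c j *s mpow A j w)) = (\<Sum>j<k. c j * \<psi> (mpow A (i + j) w))"
  by (simp add: vec.linear_sum[OF linear_mpow] vec.linear_scale[OF linear_mpow] mpow_mpow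
      vec_functional.linear_sum[OF lin] vec_functional.linear_scale[OF lin])

lemma hankel_normalized_inj:
  assumes H: "hankel_normalized A \<psi> w k"
    and zero: "\<forall>i<k. \<psi> (mpow A i (\<Sum>j<k. c j *s mpow A j w)) = 0"
  shows "\<forall>j<k. c j = 0"
proof (rule ccontr)
  assume "\<not> ?thesis"
  then obtain m where m: "m < k" "c m \<noteq> 0" and above: "\<forall>j. m < j \<and> j < k \<longrightarrow> c j = 0"
    using last_nonzero_index by blast
  have "\<psi> (mpow A (k - 1 - m) (\<Sum>j<k. c j *s mpow A j w))
      = (\<Sum>j<k. c j * \<psi> (mpow A (k - 1 - m + j) w))"
    by (rule functional_mpow_krylov_sum)
  also have "\<dots> = (\<Sum>j<k. if j = m then c m else 0)"
  proof (rule sum.cong[OF refl])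
    fix j assume "j \<in> {..<k}"
    then show "c j * \<psi> (mpow A (k - 1 - m + j) w) = (if j = m then c m else 0)"
      using H above m(1) by (cases "j \<le> m") (auto simp: hankel_normalized_def)
  qed
  also have "\<dots> = c m" using m(1) by simp
  finally show False using zero m by simp
qed

lemma hankel_normalized_solve:
  assumes H: "hankel_normalized A \<psi> w k"
  shows "\<exists>c. \<forall>i<k. \<psi> (mpow A i (\<Sum>j<k. c j *s mpow A j w)) = t i"
proof -
  have "\<exists>c. \<forall>i<m. \<psi> (mpow A i (\<Sum>j<k. c j *s mpow A j w)) = t i" if "m \<le> k" for m
    using that
  proof (induction m)
    case 0
    then show ?case by simp
  next
    case (Suc m)
    then obtain c where c: "\<forall>i<m. \<psi> (mpow A i (\<Sum>j<k. c j *s mpow A j w)) = t i"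
      by auto
    define z where "z = (\<Sum>j<k. c j *s mpow A j w)"
    define l where "l = k - 1 - m"
    define d where "d = t m - \<psi> (mpow A m z)"
    define c' where "c' j = c j + (if j = l then d else 0)" for j
    have "l < k" using Suc.prems by (simp add: l_def)
    then have z': "(\<Sum>j<k. c' j *s mpow A j w) = z + d *s mpow A l w"
      by (simp add: c'_def z_def vector_sadd_rdistrib sum.distrib
          if_distrib[where f="\<lambda>a. a *s _"] cong: if_cong)
    have unit: "\<psi> (mpow A i (mpow A l w)) = (if i = m then 1 else 0)" if "i \<le> m" for i
    proof -
      have "i + l < k" "i + l = k - 1 \<longleftrightarrow> i = m" using that Suc.prems by (auto simp: l_def)
      then show ?thesis using H by (simp add: hankel_normalized_def mpow_mpow)
    qed
    have "\<psi> (mpow A i (\<Sum>j<k. c' j *s mpow A j w)) = t i" if "i < Suc m" for i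
    proof -
      have "\<psi> (mpow A i (\<Sum>j<k. c' j *s mpow A j w))
          = \<psi> (mpow A i z) + d * \<psi> (mpow A i (mpow A l w))"
        by (simp add: z' vec.linear_add[OF linear_mpow] vec.linear_scale[OF linear_mpow]
            vec_functional.linear_add[OF lin] vec_functional.linear_scale[OF lin])
      then show ?thesis
        using that c unit[of i] by (cases "i = m") (auto simp: d_def z_def)
    qed
    then show ?case by blast
  qed
  then show ?thesis by blast
qed

lemma hankel_normalized_no_recurrence:
  assumes W: "invariant_subspace A W" and w: "w \<in> W" and H: "hankel_normalized A \<psi> w k"
    and m: "m < k"
  shows "\<not> has_recurrence A W \<psi> m"
proof
  assume "has_recurrence A W \<psi> m"
  then obtain c where c: "\<forall>x\<in>W. \<psi> (mpow A m x) = (\<Sum>i<m. c i * \<psi> (mpow A i x))"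
    unfolding has_recurrence_def by blast
  define x where "x = mpow A (k - 1 - m) w"
  have "m + (k - 1 - m) = k - 1" "k - 1 < k" using m by auto
  then have "\<psi> (mpow A m x) = 1"
    using H by (simp add: hankel_normalized_def x_def mpow_mpow)
  moreover have "\<psi> (mpow A i x) = 0" if "i < m" for i
  proof -
    have "i + (k - 1 - m) < k" "i + (k - 1 - m) \<noteq> k - 1" using m that by auto
    then show ?thesis using H by (simp add: hankel_normalized_def x_def mpow_mpow)
  qed
  moreover have "x \<in> W" unfolding x_def by (rule mpow_in_invariant_subspace[OF W w])
  ultimately show False using c by simp
qed

lemma krylov_indep_if_hankel_normalized:
  assumes "hankel_normalized A \<psi> w k"
  shows "krylov_indep A w k"
  unfolding krylov_indep_def
proof (rule allI, rule impI)
  fix c assume "(\<Sum>j<k. c j *s mpow A j w) = 0"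
  then have "\<forall>i<k. \<psi> (mpow A i (\<Sum>j<k. c j *s mpow A j w)) = 0"
    by (simp add: vec.linear_0[OF linear_mpow] vec_functional.linear_0[OF lin])
  then show "\<forall>j<k. c j = 0" by (rule hankel_normalized_inj[OF assms])
qed

lemma invariant_hankel_kernel:
  assumes W: "invariant_subspace A W" and rec: "has_recurrence A W \<psi> k"
  shows "invariant_subspace A (hankel_kernel A W \<psi> k)"
proof -
  have "vec.subspace W" using W by (simp add: invariant_subspace_def)
  then have "vec.subspace (hankel_kernel A W \<psi> k)"
    by (auto simp: hankel_kernel_def vec.subspace_def vec.linear_0[OF linear_mpow]
        vec.linear_add[OF linear_mpow] vec.linear_scale[OF linear_mpow]
        vec_functional.linear_0[OF lin] vec_functional.linear_add[OF lin]
        vec_functional.linear_scale[OF lin])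
  moreover have "A *v x \<in> hankel_kernel A W \<psi> k" if x: "x \<in> hankel_kernel A W \<psi> k" for x
  proof -
    obtain r where r: "\<forall>x\<in>W. \<psi> (mpow A k x) = (\<Sum>i<k. r i * \<psi> (mpow A i x))"
      using rec unfolding has_recurrence_def by blast
    have "\<psi> (mpow A i (A *v x)) = 0" if "i < k" for i
    proof (cases "Suc i < k")
      case True
      then show ?thesis using x by (simp add: hankel_kernel_def flip: mpow_Suc_right)
    next
      case False
      then have "Suc i = k" using \<open>i < k\<close> by simp
      then show ?thesis using r x by (simp add: hankel_kernel_def flip: mpow_Suc_right)
    qed
    then show ?thesis using W x by (simp add: hankel_kernel_def invariant_subspace_def)
  qed
  ultimately show ?thesis by (simp add: invariant_subspace_def)
qed

lemma cyclic_subspace_inter_hankel_kernel: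
  assumes H: "hankel_normalized A \<psi> w k"
  shows "cyclic_subspace A w k \<inter> hankel_kernel A W \<psi> k \<subseteq> {0}"
proof
  fix x assume "x \<in> cyclic_subspace A w k \<inter> hankel_kernel A W \<psi> k"
  then obtain c where "x = (\<Sum>j<k. c j *s mpow A j w)" "\<forall>i<k. \<psi> (mpow A i x) = 0"
    by (auto simp: cyclic_subspace_def hankel_kernel_def)
  then show "x \<in> {0}" using hankel_normalized_inj[OF H, of c] by simp
qed

lemma cyclic_subspace_plus_hankel_kernel:
  assumes W: "invariant_subspace A W" and w: "w \<in> W" and H: "hankel_normalized A \<psi> w k"
    and x: "x \<in> W"
  shows "\<exists>z\<in>cyclic_subspace A w k. \<exists>y\<in>hankel_kernel A W \<psi> k. x = z + y"
proof -
  obtain c where c: "\<forall>i<k. \<psi> (mpow A i (\<Sum>j<k. c j *s mpow A j w)) = \<psi> (mpow A i x)"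
    using hankel_normalized_solve[OF H, of "\<lambda>i. \<psi> (mpow A i x)"] by blast
  define z where "z = (\<Sum>j<k. c j *s mpow A j w)"
  have z: "z \<in> cyclic_subspace A w k"
    unfolding z_def cyclic_subspace_def mem_Collect_eq by (intro exI[of _ c]) simp
  have "x - z \<in> W"
    using z cyclic_subspace_subset[OF W w] W x
    by (intro vec.subspace_diff) (auto simp: invariant_subspace_def)
  moreover have "\<forall>i<k. \<psi> (mpow A i (x - z)) = 0"
    using c by (simp add: z_def vec.linear_diff[OF linear_mpow] vec_functional.linear_diff[OF lin])
  ultimately have "x - z \<in> hankel_kernel A W \<psi> k" by (simp add: hankel_kernel_def)
  then show ?thesis using z by force
qed

end

lemma krylov_indep_no_recurrence:
  assumes W: "invariant_subspace A W" and u: "u \<in> W" and indep: "krylov_indep A u j"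
  obtains \<phi> where "Vector_Spaces.linear (*s) (*) \<phi>" "\<And>m. m < j \<Longrightarrow> \<not> has_recurrence A W \<phi> m"
proof -
  have coeffs: "\<forall>i<j. c i = 0" if "(\<Sum>i<j. c i *s mpow A i u) = 0" for c
    using indep that by (simp add: krylov_indep_def)
  obtain \<phi> where lin: "Vector_Spaces.linear (*s) (*) \<phi>"
    and "\<forall>i<j. \<phi> (mpow A i u) = (if i = j - 1 then 1 else 0)"
    using functional_interpolates_independent[where u="\<lambda>i. mpow A i u"
        and t="\<lambda>i. if i = j - 1 then 1 else 0", OF coeffs] by blast
  then have "hankel_normalized A \<phi> u j" by (simp add: hankel_normalized_def)
  then show thesis using that[OF lin] hankel_normalized_no_recurrence[OF lin W u] by blast
qed

lemma hankel_normalized_exists: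
  assumes W: "vec.subspace W" and lin: "Vector_Spaces.linear (*s) (*) \<psi>"
    and no_rec: "\<And>m. m < k \<Longrightarrow> \<not> has_recurrence A W \<psi> m"
  obtains w where "w \<in> W" "hankel_normalized A \<psi> w k"
proof -
  have lin_i: "Vector_Spaces.linear (*s) (*) (\<lambda>x. \<psi> (mpow A i x))" for i
    using Vector_Spaces.linear_compose[OF linear_mpow lin] by (simp add: comp_def)
  have coeffs: "\<forall>i<k. c i = 0" if "\<forall>x\<in>W. (\<Sum>i<k. c i * \<psi> (mpow A i x)) = 0" for c
    using functionals_independent_if_no_recurrence[OF no_rec that] by blast
  obtain w where "w \<in> W" "\<forall>i<k. \<psi> (mpow A i w) = (if i = k - 1 then 1 else 0)"
    using independent_functionals_interpolate[where \<psi>="\<lambda>i x. \<psi> (mpow A i x)"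
        and t="\<lambda>i. if i = k - 1 then 1 else 0", OF W lin_i coeffs] by blast
  then show thesis using that by (simp add: hankel_normalized_def)
qed

lemma cyclic_summand_exists:
  fixes A :: "'a::{field,finite}^'n^'n"
  assumes W: "invariant_subspace A W" and nonzero: "\<exists>z\<in>W. z \<noteq> 0"
  obtains w k W' where "w \<in> W" "1 \<le> k" "krylov_indep A w k"
    "mpow A k w \<in> cyclic_subspace A w k" "invariant_subspace A W'" "W' \<subseteq> W" "w \<notin> W'"
    "cyclic_subspace A w k \<inter> W' \<subseteq> {0}" "\<forall>x\<in>W. \<exists>z\<in>cyclic_subspace A w k. \<exists>y\<in>W'. x = z + y"
proof -
  define order where "order \<psi> = (LEAST m. has_recurrence A W \<psi> m)" for \<psi>
  have order_rec: "has_recurrence A W \<psi> (order \<psi>)" for \<psi>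
    unfolding order_def using has_recurrence_exists by (rule LeastI_ex)
  have order_min: "\<not> has_recurrence A W \<psi> m" if "m < order \<psi>" for \<psi> m
    using that unfolding order_def by (rule not_less_Least)
  let ?L = "{\<psi> :: 'a^'n \<Rightarrow> 'a. Vector_Spaces.linear (*s) (*) \<psi>}"
  define k where "k = Max (order ` ?L)"
  have fin: "finite (order ` ?L)" and ne: "order ` ?L \<noteq> {}"
    using vec_functional.linear_zero by (auto intro: finite_imageI finite_subset[OF subset_UNIV])
  obtain \<psi> where lin: "Vector_Spaces.linear (*s) (*) \<psi>" and order_\<psi>: "order \<psi> = k"
    using Max_in[OF fin ne] unfolding k_def by auto
  have bound: "j \<le> k" if u: "u \<in> W" and indep: "krylov_indep A u j" for u j
  proof -
    obtain \<phi> where lin_\<phi>: "Vector_Spaces.linear (*s) (*) \<phi>"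
      and "\<And>m. m < j \<Longrightarrow> \<not> has_recurrence A W \<phi> m"
      using krylov_indep_no_recurrence[OF W u indep] by blast
    then have "\<not> order \<phi> < j" using order_rec by blast
    moreover have "order \<phi> \<le> k" using lin_\<phi> fin unfolding k_def by (intro Max_ge) auto
    ultimately show ?thesis by simp
  qed
  obtain z where "z \<in> W" "z \<noteq> 0" using nonzero by blast
  then have k: "1 \<le> k" using bound[of z 1] by (simp add: krylov_indep_def)
  have "vec.subspace W" using W by (simp add: invariant_subspace_def)
  then obtain w where w: "w \<in> W" and H: "hankel_normalized A \<psi> w k"
    using hankel_normalized_exists[OF _ lin] order_min order_\<psi> by blast
  have indep: "krylov_indep A w k" by (rule krylov_indep_if_hankel_normalized[OF lin H])
  have closed: "mpow A k w \<in> cyclic_subspace A w k"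
  proof (rule ccontr)
    assume "mpow A k w \<notin> cyclic_subspace A w k"
    then have "krylov_indep A w (Suc k)" by (rule krylov_indep_Suc[OF indep])
    then show False using bound[OF w] by fastforce
  qed
  have rec: "has_recurrence A W \<psi> k" using order_rec[of \<psi>] order_\<psi> by simp
  show thesis
  proof (rule that[OF w k indep closed invariant_hankel_kernel[OF lin W rec]])
    show "hankel_kernel A W \<psi> k \<subseteq> W" by (auto simp: hankel_kernel_def)
    show "w \<notin> hankel_kernel A W \<psi> k"
      using H k by (auto simp: hankel_kernel_def hankel_normalized_def)
    show "cyclic_subspace A w k \<inter> hankel_kernel A W \<psi> k \<subseteq> {0}"
      by (rule cyclic_subspace_inter_hankel_kernel[OF lin H])
    show "\<forall>x\<in>W. \<exists>z\<in>cyclic_subspace A w k. \<exists>y\<in>hankel_kernel A W \<psi> k. x = z + y"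
      using cyclic_subspace_plus_hankel_kernel[OF lin W w H] by blast
  qed
qed

section \<open>Newton bases of cyclic subspaces\<close>

definition newton_poly :: "(nat \<Rightarrow> 'a::field) \<Rightarrow> nat \<Rightarrow> 'a poly" where
  "newton_poly a j = (\<Prod>l<j. [:- a l, 1:])"

lemma newton_poly_Suc: "newton_poly a (Suc j) = [:- a j, 1:] * newton_poly a j"
  by (simp add: newton_poly_def mult.commute)

lemma degree_newton_poly: "degree (newton_poly a j) = j"
  unfolding newton_poly_def by (subst degree_prod_sum_eq) auto

lemma coeff_newton_poly_self: "coeff (newton_poly a j) j = 1"
  using lead_coeff_prod[of "\<lambda>l. [:- a l, 1:]" "{..<j}"]
  by (simp add: degree_newton_poly flip: newton_poly_def)

lemma coeff_newton_poly_above: "j < i \<Longrightarrow> coeff (newton_poly a j) i = 0"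
  by (simp add: coeff_eq_0 degree_newton_poly)

lemma coeff_newton_poly_below: "coeff (newton_poly a (Suc j)) j = - (\<Sum>l<Suc j. a l)"
proof (induction j)
  case 0
  then show ?case by (simp add: newton_poly_def)
next
  case (Suc j)
  have "newton_poly a (Suc (Suc j)) = smult (- a (Suc j)) (newton_poly a (Suc j))
      + pCons 0 (newton_poly a (Suc j))"
    by (simp add: newton_poly_Suc[of a "Suc j"] mult_pCons_left)
  then show ?case using Suc by (simp add: coeff_newton_poly_self)
qed

lemma newton_poly_basis:
  assumes "\<forall>i\<ge>m. coeff r i = 0"
  shows "\<exists>\<rho>. r = (\<Sum>j<m. smult (\<rho> j) (newton_poly a j))"
  using assms
proof (induction m arbitrary: r)
  case 0
  then have "r = 0" by (intro poly_eqI) auto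
  then show ?case by simp
next
  case (Suc m)
  have "\<forall>i\<ge>m. coeff (r - smult (coeff r m) (newton_poly a m)) i = 0"
  proof (intro allI impI)
    fix i assume "m \<le> i"
    then show "coeff (r - smult (coeff r m) (newton_poly a m)) i = 0"
      using Suc.prems by (cases "i = m") (auto simp: coeff_newton_poly_self coeff_newton_poly_above)
  qed
  then obtain \<rho>
    where \<rho>: "r - smult (coeff r m) (newton_poly a m) = (\<Sum>j<m. smult (\<rho> j) (newton_poly a j))"
    using Suc.IH by blast
  have "r = (\<Sum>j<Suc m. smult ((\<rho>(m := coeff r m)) j) (newton_poly a j))"
    using \<rho> by (simp add: algebra_simps)
  then show ?case by blast
qed

lemma newton_poly_independent:
  assumes "(\<Sum>j<m. smult (\<rho> j) (newton_poly a j)) = 0"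
  shows "\<forall>j<m. \<rho> j = 0"
  using assms
proof (induction m)
  case 0
  then show ?case by simp
next
  case (Suc m)
  have "coeff (\<Sum>j<Suc m. smult (\<rho> j) (newton_poly a j)) m = (\<Sum>j<Suc m. if j = m then \<rho> m else 0)"
    unfolding coeff_sum
    by (intro sum.cong) (auto simp: coeff_newton_poly_self coeff_newton_poly_above)
  then have "\<rho> m = 0" using Suc.prems by (simp del: sum.lessThan_Suc)
  then show ?case using Suc by (auto simp: less_Suc_eq)
qed

lemma poly_map_matrix_eq_sum:
  "\<forall>i\<ge>k. coeff r i = 0 \<Longrightarrow> poly_map ((*v) A) r w = (\<Sum>i<k. coeff r i *s mpow A i w)"
  by (simp add: poly_map_eq_sum mpow_def)

definition newton_vec :: "'a::field^'n^'n \<Rightarrow> (nat \<Rightarrow> 'a) \<Rightarrow> 'a^'n \<Rightarrow> nat \<Rightarrow> 'a^'n" where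
  "newton_vec A a w j = poly_map ((*v) A) (newton_poly a j) w"

lemma newton_vec_Suc:
  "A *v newton_vec A a w j = a j *s newton_vec A a w j + newton_vec A a w (Suc j)"
  unfolding newton_vec_def newton_poly_Suc poly_map_mult[OF matrix_vector_mul_linear_gen]
    poly_map_linear_factor[OF matrix_vector_mul_linear_gen]
  by simp

lemma newton_vec_sum:
  "(\<Sum>j<m. \<rho> j *s newton_vec A a w j) = poly_map ((*v) A) (\<Sum>j<m. smult (\<rho> j) (newton_poly a j)) w"
  by (simp add: newton_vec_def poly_map_sum poly_map_smult)

lemma newton_vec_independent:
  assumes indep: "krylov_indep A w k" and zero: "(\<Sum>j<k. \<rho> j *s newton_vec A a w j) = 0"
  shows "\<forall>j<k. \<rho> j = 0"
proof -
  let ?r = "\<Sum>j<k. smult (\<rho> j) (newton_poly a j)"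
  have high: "\<forall>i\<ge>k. coeff ?r i = 0"
    by (auto simp: coeff_sum coeff_newton_poly_above)
  then have "\<forall>i<k. coeff ?r i = 0"
    using indep zero unfolding krylov_indep_def newton_vec_sum poly_map_matrix_eq_sum[OF high]
    by blast
  then have "?r = 0" using high by (intro poly_eqI) (metis coeff_0 not_le)
  then show ?thesis by (rule newton_poly_independent)
qed

lemma span_newton_vec: "vec.span (newton_vec A a w ` {..<k}) = cyclic_subspace A w k"
proof
  show "vec.span (newton_vec A a w ` {..<k}) \<subseteq> cyclic_subspace A w k"
  proof (rule vec.span_minimal[OF _ subspace_cyclic_subspace], rule image_subsetI)
    fix j assume "j \<in> {..<k}"
    then have "newton_vec A a w j = (\<Sum>i<k. coeff (newton_poly a j) i *s mpow A i w)"
      unfolding newton_vec_def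
      by (intro poly_map_matrix_eq_sum) (auto simp: coeff_newton_poly_above)
    then show "newton_vec A a w j \<in> cyclic_subspace A w k"
      unfolding cyclic_subspace_def mem_Collect_eq
      by (intro exI[of _ "\<lambda>i. coeff (newton_poly a j) i"]) simp
  qed
  show "cyclic_subspace A w k \<subseteq> vec.span (newton_vec A a w ` {..<k})"
  proof
    fix x assume "x \<in> cyclic_subspace A w k"
    then obtain d where d: "x = (\<Sum>j<k. d j *s mpow A j w)" by (auto simp: cyclic_subspace_def)
    define r where "r = (\<Sum>j<k. monom (d j) j)"
    have r: "\<forall>i\<ge>k. coeff r i = 0" by (auto simp: r_def coeff_sum coeff_monom)
    obtain \<rho> where \<rho>: "r = (\<Sum>j<k. smult (\<rho> j) (newton_poly a j))"
      using newton_poly_basis[OF r] by blast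
    have "x = poly_map ((*v) A) r w"
      unfolding d poly_map_matrix_eq_sum[OF r]
      by (intro sum.cong) (auto simp: r_def coeff_sum coeff_monom)
    also have "\<dots> = (\<Sum>j<k. \<rho> j *s newton_vec A a w j)"
      by (simp add: \<rho> newton_vec_sum)
    also have "\<dots> \<in> vec.span (newton_vec A a w ` {..<k})"
      by (intro vec.span_sum vec.span_scale vec.span_base) auto
    finally show "x \<in> vec.span (newton_vec A a w ` {..<k})" .
  qed
qed

text \<open>Only the coefficient of the last basis vector matters below: it is the trace
  \<open>c (k - 1)\<close> of \<open>A\<close> on the cyclic subspace minus the nodes \<open>a 0, \<dots>, a (k - 2)\<close>.\<close>

lemma newton_vec_last:
  assumes k: "1 \<le> k" and rec: "mpow A k w = (\<Sum>j<k. c j *s mpow A j w)"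
  shows "\<exists>\<rho>. A *v newton_vec A a w (k - 1)
    = (c (k - 1) - (\<Sum>l<k - 1. a l)) *s newton_vec A a w (k - 1)
      + (\<Sum>j<k - 1. \<rho> j *s newton_vec A a w j)"
proof -
  define \<gamma> where "\<gamma> = c (k - 1) - (\<Sum>l<k - 1. a l)"
  define p where "p = monom 1 k - (\<Sum>i<k. monom (c i) i)"
  define R where "R = pCons 0 (newton_poly a (k - 1)) - p - smult \<gamma> (newton_poly a (k - 1))"
  have "poly_map ((*v) A) p w = 0"
    using rec by (simp add: p_def poly_map_diff poly_map_sum poly_map_monom mpow_def)
  then have "A *v newton_vec A a w (k - 1) = \<gamma> *s newton_vec A a w (k - 1) + poly_map ((*v) A) R w"
    by (simp add: R_def newton_vec_def poly_map_diff poly_map_smult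
        poly_map_pCons_0[OF matrix_vector_mul_linear_gen])
  \<comment> \<open>\<open>X \<cdot> newton_poly a (k - 1)\<close> and \<open>p\<close> are monic of degree \<open>k\<close>, and \<open>\<gamma>\<close> cancels their
    difference in degree \<open>k - 1\<close>.\<close>
  moreover have "\<forall>i\<ge>k - 1. coeff R i = 0"
  proof (intro allI impI)
    fix i assume "k - 1 \<le> i"
    then consider "i = k - 1" "k = 1" | "i = k - 1" "k \<ge> 2" | "i \<ge> k" using k by linarith
    then show "coeff R i = 0"
    proof cases
      case 2
      then have e: "k - 1 = Suc (k - 2)" by simp
      have "coeff (pCons 0 (newton_poly a (k - 1))) (k - 1) = - (\<Sum>l<k - 1. a l)"
        unfolding e coeff_pCons_Suc by (rule coeff_newton_poly_below)
      then show ?thesis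
        using 2 by (simp add: R_def p_def \<gamma>_def coeff_sum coeff_monom coeff_newton_poly_self)
    next
      case 3
      then obtain i' where i': "i = Suc i'" "k - 1 \<le> i'" using k by (cases i) auto
      then have "coeff (pCons 0 (newton_poly a (k - 1))) i = coeff (newton_poly a (k - 1)) i'"
        by simp
      then show ?thesis
        using 3 k i' by (cases "i' = k - 1")
          (auto simp: R_def p_def coeff_sum coeff_monom coeff_newton_poly_self
            coeff_newton_poly_above)
    qed (simp_all add: R_def p_def \<gamma>_def coeff_sum coeff_monom newton_poly_def)
  qed
  then obtain \<rho> where "R = (\<Sum>j<k - 1. smult (\<rho> j) (newton_poly a j))"
    using newton_poly_basis by blast
  ultimately show ?thesis by (auto simp: \<gamma>_def newton_vec_sum)
qed

section \<open>Square-zero plus diagonalizable on a cyclic block\<close>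

definition vanishing_poly :: "'a::field set \<Rightarrow> 'a poly" where
  "vanishing_poly S = (\<Prod>t\<in>S. [:- t, 1:])"

lemma vanishing_poly_remove:
  assumes "finite S" "\<mu> \<in> S" "Vector_Spaces.linear (*s) (*s) D"
  shows "poly_map D (vanishing_poly S) x = poly_map D (vanishing_poly (S - {\<mu>})) (D x - \<mu> *s x)"
proof -
  have "vanishing_poly S = vanishing_poly (S - {\<mu>}) * [:- \<mu>, 1:]"
    unfolding vanishing_poly_def using assms by (simp add: prod.remove mult.commute)
  then show ?thesis by (simp only: poly_map_mult[OF assms(3)] poly_map_linear_factor[OF assms(3)])
qed

lemma vanishing_poly_eigenvector:
  assumes "finite S" "\<mu> \<in> S" "Vector_Spaces.linear (*s) (*s) D" "D x = \<mu> *s x"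
  shows "poly_map D (vanishing_poly S) x = 0"
  using vanishing_poly_remove[OF assms(1-3), of x] assms(4)
    vec.linear_0[OF linear_poly_map[OF assms(3)]] by simp

definition nil_part :: "'a::field^'n^'n \<Rightarrow> ('a^'n \<Rightarrow> 'a^'n) \<Rightarrow> 'a^'n \<Rightarrow> 'a^'n" where
  "nil_part A D x = A *v x - D x"

lemma linear_nil_part:
  "Vector_Spaces.linear (*s) (*s) D \<Longrightarrow> Vector_Spaces.linear (*s) (*s) (nil_part A D)"
  unfolding nil_part_def by (rule vec.linear_compose_sub[OF matrix_vector_mul_linear_gen])

text \<open>A linear map annihilated by \<open>vanishing_poly UNIV = \<Prod>\<^sub>t\<^sub>\<in>\<^sub>F (X - t)\<close> is diagonalizable, its
  minimal polynomial having simple roots.\<close>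

definition nd_decomposition :: "'a::{field,finite}^'n^'n \<Rightarrow> ('a^'n) set \<Rightarrow> ('a^'n \<Rightarrow> 'a^'n) \<Rightarrow> bool"
  where "nd_decomposition A W D \<longleftrightarrow> Vector_Spaces.linear (*s) (*s) D \<and> (\<forall>x\<in>W. D x \<in> W)
    \<and> (\<forall>x\<in>W. poly_map D (vanishing_poly UNIV) x = 0) \<and> (\<forall>x\<in>W. nil_part A D (nil_part A D x) = 0)"

text \<open>In the Newton basis \<open>v\<close>, the map \<open>D\<close> below is triangular with diagonal
  \<open>a 0, \<dots>, a (k - 2), \<gamma>\<close>. These conditions keep the diagonal entries distinct along every chain
  of nonzero off-diagonal entries, which makes \<open>D\<close> diagonalizable.\<close>

definition admissible_nodes :: "nat \<Rightarrow> 'a \<Rightarrow> (nat \<Rightarrow> 'a) \<Rightarrow> bool" where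
  "admissible_nodes k \<gamma> a \<longleftrightarrow>
     (\<forall>j. j + 2 < k \<longrightarrow> odd (k - 1 - j) \<longrightarrow> a j \<noteq> a (Suc j)) \<and>
     (\<forall>j. j + 1 < k \<longrightarrow> even (k - 1 - j) \<longrightarrow> a j \<noteq> \<gamma> \<and> a j \<noteq> a (k - 2)) \<and>
     (2 \<le> k \<longrightarrow> a (k - 2) \<noteq> \<gamma>)"

text \<open>Parities refer to the distance \<open>k - 1 - j\<close> of \<open>v j\<close> from the last basis vector.\<close>

context
  fixes A :: "'a::{field,finite}^'n^'n" and D :: "'a^'n \<Rightarrow> 'a^'n" and v :: "nat \<Rightarrow> 'a^'n"
    and a \<rho> :: "nat \<Rightarrow> 'a" and \<gamma> :: 'a and k :: nat
  assumes lin: "Vector_Spaces.linear (*s) (*s) D"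
    and A_step: "\<And>j. A *v v j = a j *s v j + v (Suc j)"
    and A_last: "A *v v (k - 1) = \<gamma> *s v (k - 1) + (\<Sum>j<k - 1. \<rho> j *s v j)"
    and D_even: "\<And>j. j + 1 < k \<Longrightarrow> even (k - 1 - j) \<Longrightarrow> D (v j) = a j *s v j"
    and D_odd: "\<And>j. j + 1 < k \<Longrightarrow> odd (k - 1 - j) \<Longrightarrow> D (v j) = A *v v j"
    and D_last: "D (v (k - 1))
      = \<gamma> *s v (k - 1) + (\<Sum>j<k - 1. if even (k - 1 - j) then \<rho> j *s v j else 0)"
begin

lemma nil_part_odd: "j + 1 < k \<Longrightarrow> odd (k - 1 - j) \<Longrightarrow> nil_part A D (v j) = 0"
  by (simp add: nil_part_def D_odd)

lemma nil_part_newton_basis: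
  assumes "j < k"
  shows "nil_part A D (nil_part A D (v j)) = 0"
proof (cases "j + 1 < k")
  case True
  show ?thesis
  proof (cases "even (k - 1 - j)")
    case True
    have "j + 2 < k"
    proof (rule ccontr)
      assume "\<not> j + 2 < k"
      then have "k - 1 - j = 1" using \<open>j + 1 < k\<close> by simp
      then show False using True by (metis odd_one)
    qed
    moreover from this have "k - 1 - j = Suc (k - 1 - Suc j)" by simp
    then have "odd (k - 1 - Suc j)" using True by simp
    moreover have "nil_part A D (v j) = v (Suc j)"
      using D_even[OF \<open>j + 1 < k\<close> True] by (simp add: nil_part_def A_step)
    ultimately show ?thesis using nil_part_odd[of "Suc j"] by simp
  next
    case False
    then show ?thesis
      using \<open>j + 1 < k\<close> nil_part_odd vec.linear_0[OF linear_nil_part[OF lin]] by simp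
  qed
next
  case False
  then have j: "j = k - 1" using assms by simp
  have "nil_part A D (v (k - 1))
      = (\<Sum>i<k - 1. \<rho> i *s v i - (if even (k - 1 - i) then \<rho> i *s v i else 0))"
    unfolding nil_part_def A_last D_last by (simp add: sum_subtractf)
  also have "\<dots> = (\<Sum>i<k - 1. if odd (k - 1 - i) then \<rho> i *s v i else 0)"
    by (rule sum.cong) auto
  also have "nil_part A D \<dots> = 0"
    by (simp add: vec.linear_sum[OF linear_nil_part[OF lin]]
        vec.linear_scale[OF linear_nil_part[OF lin]] vec.linear_0[OF linear_nil_part[OF lin]]
        if_distrib[where f="nil_part A D"] nil_part_odd cong: if_cong)
  finally show ?thesis using j by simp
qed

lemma vanishing_poly_even_part:
  assumes S: "finite S" and nodes_in: "\<And>i. i + 1 < k \<Longrightarrow> even (k - 1 - i) \<Longrightarrow> a i \<in> S"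
  shows "poly_map D (vanishing_poly S) (\<Sum>i<k - 1. if even (k - 1 - i) then \<rho> i *s v i else 0) = 0"
proof -
  note lin_V = linear_poly_map[OF lin, of "vanishing_poly S"]
  have "poly_map D (vanishing_poly S) (if even (k - 1 - i) then \<rho> i *s v i else 0) = 0"
    if "i < k - 1" for i
  proof (cases "even (k - 1 - i)")
    case True
    have "i + 1 < k" using that by simp
    then have "poly_map D (vanishing_poly S) (v i) = 0"
      using vanishing_poly_eigenvector[OF S nodes_in lin D_even] True by blast
    then show ?thesis using True by (simp add: vec.linear_scale[OF lin_V])
  qed (simp add: vec.linear_0[OF lin_V])
  then show ?thesis by (simp add: vec.linear_sum[OF lin_V])
qed

lemma vanishing_poly_newton_basis:
  assumes nodes: "admissible_nodes k \<gamma> a" and j: "j < k"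
  shows "poly_map D (vanishing_poly UNIV) (v j) = 0"
proof -
  have G1: "\<And>j. j + 2 < k \<Longrightarrow> odd (k - 1 - j) \<Longrightarrow> a j \<noteq> a (Suc j)"
    and G2: "\<And>j. j + 1 < k \<Longrightarrow> even (k - 1 - j) \<Longrightarrow> a j \<noteq> \<gamma> \<and> a j \<noteq> a (k - 2)"
    and G3: "2 \<le> k \<Longrightarrow> a (k - 2) \<noteq> \<gamma>"
    using nodes by (auto simp: admissible_nodes_def)
  have last: "poly_map D (vanishing_poly S) (v (k - 1)) = 0"
    if S: "finite S" "\<gamma> \<in> S" and nodes_in: "\<And>i. i + 1 < k \<Longrightarrow> even (k - 1 - i) \<Longrightarrow> a i \<in> S - {\<gamma>}"
    for S
    using vanishing_poly_remove[OF S lin, of "v (k - 1)"] D_last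
      vanishing_poly_even_part[of "S - {\<gamma>}", OF _ nodes_in] S(1) by simp
  show ?thesis
  proof (cases "j + 1 < k")
    case False
    then have "j = k - 1" using j by simp
    then show ?thesis using last[of UNIV] G2 by auto
  next
    case j1: True
    show ?thesis
    proof (cases "even (k - 1 - j)")
      case True
      then show ?thesis using vanishing_poly_eigenvector[OF _ _ lin D_even[OF j1 True]] by simp
    next
      case odd: False
      have "poly_map D (vanishing_poly UNIV) (v j)
          = poly_map D (vanishing_poly (UNIV - {a j})) (v (Suc j))"
        using vanishing_poly_remove[OF _ _ lin, of UNIV "a j" "v j"] D_odd[OF j1 odd] A_step[of j]
        by simp
      also have "\<dots> = 0"
      proof (cases "j + 2 < k")
        case True
        moreover from this have "k - 1 - j = Suc (k - 1 - Suc j)" by simp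
        then have "even (k - 1 - Suc j)" using odd by simp
        ultimately show ?thesis
          using vanishing_poly_eigenvector[OF _ _ lin D_even[of "Suc j"]] G1[of j] odd by simp
      next
        case False
        then have "Suc j = k - 1" "j = k - 2" "2 \<le> k" using j1 by auto
        then show ?thesis using last[of "UNIV - {a j}"] G2 G3 by auto
      qed
      finally show ?thesis .
    qed
  qed
qed

end

lemma linear_extension_exists:
  fixes v G :: "nat \<Rightarrow> 'a::field^'n"
  assumes inj: "inj_on v {..<k}" and indep: "vec.independent (v ` {..<k})"
  obtains D where "Vector_Spaces.linear (*s) (*s) D" "\<And>j. j < k \<Longrightarrow> D (v j) = G j"
proof
  let ?D = "vec.construct (v ` {..<k}) (\<lambda>x. G (the_inv_into {..<k} v x))"
  show "Vector_Spaces.linear (*s) (*s) ?D" by (rule vec.linear_construct[OF indep])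
  show "?D (v j) = G j" if "j < k" for j
    using that inj by (simp add: vec.construct_basis[OF indep] the_inv_into_f_f)
qed

lemma nd_decomposition_span:
  fixes A :: "'a::{field,finite}^'n^'n"
  assumes lin: "Vector_Spaces.linear (*s) (*s) D" and closed: "D ` B \<subseteq> vec.span B"
    and vanish: "\<And>b. b \<in> B \<Longrightarrow> poly_map D (vanishing_poly UNIV) b = 0"
    and nil: "\<And>b. b \<in> B \<Longrightarrow> nil_part A D (nil_part A D b) = 0"
  shows "nd_decomposition A (vec.span B) D"
proof -
  have "D ` vec.span B \<subseteq> vec.span B"
    using closed unfolding vec.linear_span_image[OF lin, symmetric] by (rule vec.span_minimal) simp
  moreover have "poly_map D (vanishing_poly UNIV) x = 0" if "x \<in> vec.span B" for x
    by (rule vec.linear_eq_0_on_span[OF linear_poly_map[OF lin] vanish that])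
  moreover have "nil_part A D (nil_part A D x) = 0" if "x \<in> vec.span B" for x
  proof -
    have "Vector_Spaces.linear (*s) (*s) (nil_part A D \<circ> nil_part A D)"
      using Vector_Spaces.linear_compose linear_nil_part[OF lin] by blast
    from vec.linear_eq_0_on_span[OF this _ that] show ?thesis using nil by simp
  qed
  ultimately show ?thesis using lin by (auto simp: nd_decomposition_def)
qed

lemma nd_decomposition_newton_basis:
  fixes A :: "'a::{field,finite}^'n^'n" and v :: "nat \<Rightarrow> 'a^'n"
  assumes k: "1 \<le> k" and inj: "inj_on v {..<k}" and indep: "vec.independent (v ` {..<k})"
    and A_step: "\<And>j. A *v v j = a j *s v j + v (Suc j)"
    and A_last: "A *v v (k - 1) = \<gamma> *s v (k - 1) + (\<Sum>j<k - 1. \<rho> j *s v j)"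
    and nodes: "admissible_nodes k \<gamma> a"
  shows "\<exists>D. nd_decomposition A (vec.span (v ` {..<k})) D"
proof -
  define G where "G j = (if j + 1 < k then if even (k - 1 - j) then a j *s v j else A *v v j
      else \<gamma> *s v j + (\<Sum>i<k - 1. if even (k - 1 - i) then \<rho> i *s v i else 0))" for j
  obtain D where lin: "Vector_Spaces.linear (*s) (*s) D" and D_v: "\<And>j. j < k \<Longrightarrow> D (v j) = G j"
    using linear_extension_exists[OF inj indep] by blast
  have D_even: "D (v j) = a j *s v j" if "j + 1 < k" "even (k - 1 - j)" for j
    using that D_v by (simp add: G_def)
  have D_odd: "D (v j) = A *v v j" if "j + 1 < k" "odd (k - 1 - j)" for j
    using that D_v by (simp add: G_def)
  have D_last: "D (v (k - 1))
      = \<gamma> *s v (k - 1) + (\<Sum>j<k - 1. if even (k - 1 - j) then \<rho> j *s v j else 0)"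
    using k D_v[of "k - 1"] by (simp add: G_def)
  note facts = lin A_step A_last D_even D_odd D_last
  have v_span: "v j \<in> vec.span (v ` {..<k})" if "j < k" for j
    using that by (auto intro: vec.span_base)
  have "G j \<in> vec.span (v ` {..<k})" if "j < k" for j
    using that v_span[of j] v_span[of "Suc j"] A_step[of j] v_span
    by (auto simp: G_def intro!: vec.span_add vec.span_scale vec.span_sum vec.span_zero)
  then have "D ` v ` {..<k} \<subseteq> vec.span (v ` {..<k})" using D_v by auto
  then show ?thesis
    using nd_decomposition_span[OF lin] vanishing_poly_newton_basis[OF facts nodes]
      nil_part_newton_basis[OF facts] by blast
qed

lemma nd_decomposition_cyclic_subspace:
  fixes A :: "'a::{field,finite}^'n^'n"
  assumes k: "1 \<le> k" and indep: "krylov_indep A w k"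
    and rec: "mpow A k w = (\<Sum>j<k. c j *s mpow A j w)"
    and nodes: "admissible_nodes k (c (k - 1) - (\<Sum>l<k - 1. a l)) a"
  shows "\<exists>D. nd_decomposition A (cyclic_subspace A w k) D"
proof -
  obtain \<rho> where last: "A *v newton_vec A a w (k - 1) = (c (k - 1) - (\<Sum>l<k - 1. a l)) *s
      newton_vec A a w (k - 1) + (\<Sum>j<k - 1. \<rho> j *s newton_vec A a w j)"
    using newton_vec_last[OF k rec] by blast
  have "\<forall>j<k. \<rho> j = 0" if "(\<Sum>j<k. \<rho> j *s newton_vec A a w j) = 0" for \<rho>
    using newton_vec_independent[OF indep that] .
  then have "inj_on (newton_vec A a w) {..<k}" "vec.independent (newton_vec A a w ` {..<k})"
    using independent_if_coefficients_vanish[where u="newton_vec A a w" and k=k] by blast+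
  then show ?thesis
    using nd_decomposition_newton_basis[OF k _ _ newton_vec_Suc last nodes]
    by (simp add: span_newton_vec)
qed

section \<open>Fields of characteristic two\<close>

lemma char2_two: "CHAR('a::field) = 2 \<Longrightarrow> (2::'a) = 0"
  using of_nat_CHAR[where 'a='a] by simp

lemma char2_add_self: "CHAR('a::field) = 2 \<Longrightarrow> (x::'a) + x = 0"
  by (simp add: char2_two flip: mult_2)

lemma char2_minus: "CHAR('a::field) = 2 \<Longrightarrow> - (x::'a) = x"
  by (rule minus_unique) (rule char2_add_self)

lemma char2_finite_sqrt:
  assumes "CHAR('a::{field,finite}) = 2"
  shows "\<exists>l::'a. l * l = c"
proof -
  have "inj (\<lambda>x::'a. x * x)"
  proof (rule injI)
    fix x y :: 'a assume sq: "x * x = y * y"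
    have "(x + y)\<^sup>2 = x\<^sup>2 + y\<^sup>2" by (simp add: power2_sum char2_two[OF assms])
    also have "\<dots> = y\<^sup>2 + y\<^sup>2" by (simp add: power2_eq_square sq)
    also have "\<dots> = 0" by (rule char2_add_self[OF assms])
    finally have "x + y = 0" by simp
    then show "x = y" using minus_unique char2_minus[OF assms] by metis
  qed
  then have "surj (\<lambda>x::'a. x * x)" by (simp add: finite_UNIV_inj_surj)
  then show ?thesis using surjD[of "\<lambda>x. x * x" c] by auto
qed

lemma exists_avoiding_three:
  assumes "CARD('a::finite) \<ge> 4"
  shows "\<exists>x::'a. x \<noteq> p \<and> x \<noteq> q \<and> x \<noteq> r"
proof -
  have "card {p, q, r} \<le> 3" by (auto simp: card_insert_if)
  then have "{p, q, r} \<noteq> (UNIV :: 'a set)" using assms by auto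
  then show ?thesis by auto
qed

section \<open>Cyclic blocks in characteristic two\<close>

lemma nd_decomposition_scalar_square:
  fixes A :: "'a::{field,finite}^'n^'n"
  assumes ch: "CHAR('a) = 2" and rec: "A *v (A *v w) = c *s w"
  shows "\<exists>D. nd_decomposition A (cyclic_subspace A w 2) D"
proof -
  obtain l :: 'a where l: "l * l = c" using char2_finite_sqrt[OF ch] by blast
  define D where "D x = l *s x" for x :: "'a^'n"
  have lin: "Vector_Spaces.linear (*s) (*s) D"
    unfolding D_def by (rule vec.linear_compose_scale_right[OF vec.linear_id[unfolded id_def]])
  note A_lin = vec.linear_add[OF matrix_vector_mul_linear_gen]
    vec.linear_scale[OF matrix_vector_mul_linear_gen]
  have A2: "A *v (A *v x) = c *s x" if x: "x \<in> cyclic_subspace A w 2" for x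
  proof -
    obtain d where "x = (\<Sum>j<2. d j *s mpow A j w)"
      using x unfolding cyclic_subspace_def by blast
    then have "x = d 0 *s w + d 1 *s (A *v w)" by (simp add: numeral_2_eq_2 mpow_Suc)
    moreover have "A *v (A *v (A *v w)) = c *s (A *v w)" by (simp add: rec A_lin)
    ultimately show ?thesis
      using rec by (simp add: A_lin vector_smult_assoc mult.commute vector_add_ldistrib)
  qed
  have "nd_decomposition A (cyclic_subspace A w 2) D"
    unfolding nd_decomposition_def
  proof (intro conjI ballI lin)
    fix x assume x: "x \<in> cyclic_subspace A w 2"
    show "D x \<in> cyclic_subspace A w 2"
      unfolding D_def by (rule vec.subspace_scale[OF subspace_cyclic_subspace x])
    show "poly_map D (vanishing_poly UNIV) x = 0"
      by (rule vanishing_poly_eigenvector[OF _ _ lin]) (auto simp: D_def)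
    have "nil_part A D (nil_part A D x)
        = (A *v (A *v x) - l *s (A *v x)) - (l *s (A *v x) - (l * l) *s x)"
      by (simp add: nil_part_def D_def vec.linear_diff[OF matrix_vector_mul_linear_gen] A_lin
          vector_ssub_ldistrib vector_smult_assoc)
    also have "\<dots> = (c + c) *s x - (l + l) *s (A *v x)"
      using A2[OF x] l by (simp add: vec_eq_iff ring_distribs)
    finally show "nil_part A D (nil_part A D x) = 0" by (simp add: char2_add_self[OF ch])
  qed
  then show ?thesis by blast
qed

definition alternating_nodes :: "nat \<Rightarrow> 'a::field \<Rightarrow> 'a \<Rightarrow> nat \<Rightarrow> 'a" where
  "alternating_nodes k \<epsilon> \<delta> l =
     (if l = 0 then \<epsilon> else if l = k - 2 then \<delta> else if even (k - 1 - l) then 0 else 1)"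

lemma admissible_alternating_nodes:
  assumes k: "3 \<le> k" and \<delta>: "\<delta> \<noteq> 0" "\<delta> \<noteq> \<gamma>" and \<gamma>: "\<gamma> \<noteq> 0"
    and \<epsilon>_even: "even k \<Longrightarrow> \<epsilon> \<noteq> 0" and \<epsilon>_odd: "odd k \<Longrightarrow> \<epsilon> \<noteq> \<gamma> \<and> \<epsilon> \<noteq> \<delta>"
  shows "admissible_nodes k \<gamma> (alternating_nodes k \<epsilon> \<delta>)"
proof -
  let ?a = "alternating_nodes k \<epsilon> \<delta>"
  have "?a j \<noteq> ?a (Suc j)" if j: "j + 2 < k" "odd (k - 1 - j)" for j
  proof -
    have "k - 1 - j = Suc (k - 1 - Suc j)" using j by simp
    then have "even (k - 1 - Suc j)" using j(2) by simp
    moreover have "Suc j \<noteq> k - 2"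
    proof
      assume "Suc j = k - 2"
      then have "k - 1 - j = 2" using j by simp
      then show False using j(2) by simp
    qed
    ultimately have "?a (Suc j) = 0" by (simp add: alternating_nodes_def)
    moreover have "?a j \<noteq> 0"
      using j \<epsilon>_even by (cases "j = 0") (auto simp: alternating_nodes_def)
    ultimately show ?thesis by simp
  qed
  moreover have "?a j \<noteq> \<gamma> \<and> ?a j \<noteq> ?a (k - 2)" if j: "j + 1 < k" "even (k - 1 - j)" for j
  proof -
    have "j \<noteq> k - 2"
    proof
      assume "j = k - 2"
      then have "k - 1 - j = 1" using k by simp
      then show False using j(2) by simp
    qed
    then show ?thesis
      using j k \<delta> \<gamma> \<epsilon>_odd by (cases "j = 0") (auto simp: alternating_nodes_def)
  qed
  moreover have "?a (k - 2) \<noteq> \<gamma>" using k \<delta> by (simp add: alternating_nodes_def)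
  ultimately show ?thesis by (simp add: admissible_nodes_def)
qed

lemma sum_alternating_nodes:
  assumes k: "3 \<le> k"
  shows "(\<Sum>l<k - 1. alternating_nodes k \<epsilon> \<delta> l)
    = \<epsilon> + \<delta> + (\<Sum>l\<in>{..<k - 1} - {0} - {k - 2}. alternating_nodes k 0 0 l)"
proof -
  let ?a = "alternating_nodes k \<epsilon> \<delta>"
  have "(\<Sum>l<k - 1. ?a l) = ?a 0 + sum ?a ({..<k - 1} - {0})"
    by (rule sum.remove) (use k in auto)
  also have "sum ?a ({..<k - 1} - {0}) = ?a (k - 2) + sum ?a ({..<k - 1} - {0} - {k - 2})"
    by (rule sum.remove) (use k in auto)
  also have "sum ?a ({..<k - 1} - {0} - {k - 2})
      = (\<Sum>l\<in>{..<k - 1} - {0} - {k - 2}. alternating_nodes k 0 0 l)"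
    by (intro sum.cong) (auto simp: alternating_nodes_def)
  finally show ?thesis using k by (simp add: alternating_nodes_def add.assoc)
qed

lemma admissible_nodes_exist:
  fixes T :: "'a::{field,finite}"
  assumes ch: "CHAR('a) = 2" and card: "CARD('a) \<ge> 4" and k: "3 \<le> k"
  shows "\<exists>a. admissible_nodes k (T - (\<Sum>l<k - 1. a l)) a"
proof -
  define T' where "T' = T - (\<Sum>l\<in>{..<k - 1} - {0} - {k - 2}. alternating_nodes k 0 0 l)"
  obtain \<delta> where \<delta>: "\<delta> \<noteq> 0" "\<delta> \<noteq> T'" using exists_avoiding_three[OF card, of 0 T' 0] by blast
  obtain \<epsilon> where \<epsilon>: "\<epsilon> \<noteq> T' - \<delta> - \<delta>" "\<epsilon> \<noteq> T' - \<delta>" "\<epsilon> \<noteq> (if even k then 0 else \<delta>)"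
    using exists_avoiding_three[OF card] by blast
  have \<gamma>: "T - (\<Sum>l<k - 1. alternating_nodes k \<epsilon> \<delta> l) = T' - \<epsilon> - \<delta>"
    unfolding sum_alternating_nodes[OF k, of \<epsilon> \<delta>] by (simp add: T'_def algebra_simps)
  have "\<epsilon> \<noteq> T' - \<epsilon> - \<delta>"
    using \<delta>(2) char2_add_self[OF ch, of \<epsilon>] by (auto simp: algebra_simps)
  then have "admissible_nodes k (T' - \<epsilon> - \<delta>) (alternating_nodes k \<epsilon> \<delta>)"
    using \<delta> \<epsilon> by (intro admissible_alternating_nodes[OF k]) (auto simp: algebra_simps)
  then show ?thesis unfolding \<gamma>[symmetric] by blast
qed

lemma nd_decomposition_cyclic:
  fixes A :: "'a::{field,finite}^'n^'n"
  assumes ch: "CHAR('a) = 2" and card: "CARD('a) \<ge> 4"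
    and k: "1 \<le> k" and indep: "krylov_indep A w k"
    and closed: "mpow A k w \<in> cyclic_subspace A w k"
  shows "\<exists>D. nd_decomposition A (cyclic_subspace A w k) D"
proof -
  obtain c where rec: "mpow A k w = (\<Sum>j<k. c j *s mpow A j w)"
    using closed unfolding cyclic_subspace_def by blast
  consider "k = 1" | "k = 2" "c 1 \<noteq> 0" | "3 \<le> k" | "k = 2" "c 1 = 0" using k by linarith
  then show ?thesis
  proof cases
    case 1
    then have "admissible_nodes k (c (k - 1) - (\<Sum>l<k - 1. 0)) (\<lambda>_. 0)"
      by (simp add: admissible_nodes_def)
    then show ?thesis by (rule nd_decomposition_cyclic_subspace[OF k indep rec])
  next
    case 2
    then have "admissible_nodes k (c (k - 1) - (\<Sum>l<k - 1. 0)) (\<lambda>_. 0)"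
      by (auto simp: admissible_nodes_def)
    then show ?thesis by (rule nd_decomposition_cyclic_subspace[OF k indep rec])
  next
    case 3
    then obtain a where "admissible_nodes k (c (k - 1) - (\<Sum>l<k - 1. a l)) a"
      using admissible_nodes_exist[OF ch card] by blast
    then show ?thesis by (rule nd_decomposition_cyclic_subspace[OF k indep rec])
  next
    case 4
    then have "A *v (A *v w) = c 0 *s w" using rec by (simp add: numeral_2_eq_2 mpow_Suc)
    then show ?thesis using 4 nd_decomposition_scalar_square[OF ch] by blast
  qed
qed

section \<open>Gluing along direct sums\<close>

lemma independent_Un_disjoint_subspaces:
  assumes Z: "vec.subspace Z" and Y: "vec.subspace Y" and disjoint: "Z \<inter> Y \<subseteq> {0}"
    and B0: "B0 \<subseteq> Z" "vec.independent B0" and B1: "B1 \<subseteq> Y" "vec.independent B1"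
  shows "vec.independent (B0 \<union> B1)"
proof (rule vec.independent_if_scalars_zero)
  have fin: "finite B0" "finite B1" using B0(2) B1(2) by (simp_all add: vec.finiteI_independent)
  then show "finite (B0 \<union> B1)" by simp
  fix f x assume s: "(\<Sum>x\<in>B0 \<union> B1. f x *s x) = 0" and x: "x \<in> B0 \<union> B1"
  define z where "z = (\<Sum>x\<in>B0. f x *s x)"
  define y where "y = (\<Sum>x\<in>B1. f x *s x)"
  have "z \<in> Z"
    unfolding z_def using Z B0(1) by (intro vec.subspace_sum vec.subspace_scale) auto
  moreover have "y \<in> Y"
    unfolding y_def using Y B1(1) by (intro vec.subspace_sum vec.subspace_scale) auto
  moreover have "B0 \<inter> B1 = {}"
    using disjoint B0 B1(1) vec.dependent_zero by blast
  then have "z = - y"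
    using s fin by (simp add: z_def y_def sum.union_disjoint eq_neg_iff_add_eq_0)
  ultimately have "z = 0" "y = 0" using disjoint vec.subspace_neg[OF Y] by auto
  then show "f x = 0"
    using x B0(2) B1(2) unfolding z_def y_def vec.independent_explicit by (metis Un_iff fin)
qed

lemma linear_glue:
  fixes D0 D1 :: "'a::field^'n \<Rightarrow> 'a^'n"
  assumes Z: "vec.subspace Z" and Y: "vec.subspace Y" and disjoint: "Z \<inter> Y \<subseteq> {0}"
    and lin0: "Vector_Spaces.linear (*s) (*s) D0" and lin1: "Vector_Spaces.linear (*s) (*s) D1"
  obtains D where "Vector_Spaces.linear (*s) (*s) D" "\<forall>x\<in>Z. D x = D0 x" "\<forall>x\<in>Y. D x = D1 x"
proof -
  obtain B0 where B0: "B0 \<subseteq> Z" "vec.independent B0" "Z \<subseteq> vec.span B0"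
    by (meson vec.basis_exists)
  obtain B1 where B1: "B1 \<subseteq> Y" "vec.independent B1" "Y \<subseteq> vec.span B1"
    by (meson vec.basis_exists)
  have indep: "vec.independent (B0 \<union> B1)"
    using independent_Un_disjoint_subspaces[OF Z Y disjoint B0(1,2) B1(1,2)] .
  have disj: "B0 \<inter> B1 = {}"
    using disjoint B0 B1(1) vec.dependent_zero by blast
  define D where "D = vec.construct (B0 \<union> B1) (\<lambda>b. if b \<in> B0 then D0 b else D1 b)"
  have lin: "Vector_Spaces.linear (*s) (*s) D"
    unfolding D_def by (rule vec.linear_construct[OF indep])
  have D_basis: "D b = (if b \<in> B0 then D0 b else D1 b)" if "b \<in> B0 \<union> B1" for b
    unfolding D_def by (rule vec.construct_basis[OF indep that])
  show thesis
  proof (rule that[OF lin])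
    show "\<forall>x\<in>Z. D x = D0 x"
    proof
      fix x assume "x \<in> Z"
      show "D x = D0 x"
        by (rule vec.linear_eq_on_span[OF lin lin0, where B=B0])
          (use B0(3) \<open>x \<in> Z\<close> in \<open>auto simp: D_basis\<close>)
    qed
    show "\<forall>x\<in>Y. D x = D1 x"
    proof
      fix x assume "x \<in> Y"
      show "D x = D1 x"
        by (rule vec.linear_eq_on_span[OF lin lin1, where B=B1])
          (use B1(3) disj \<open>x \<in> Y\<close> in \<open>auto simp: D_basis\<close>)
    qed
  qed
qed

lemma poly_map_local:
  assumes "\<forall>x\<in>Z. D x = D0 x" "\<forall>x\<in>Z. D0 x \<in> Z" "z \<in> Z"
  shows "poly_map D q z = poly_map D0 q z"
proof -
  have "(D ^^ i) z = (D0 ^^ i) z \<and> (D0 ^^ i) z \<in> Z" for i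
    by (induction i) (use assms in auto)
  then show ?thesis by (simp add: poly_map_def)
qed

lemma nd_decomposition_direct_sum:
  fixes A :: "'a::{field,finite}^'n^'n"
  assumes Z: "invariant_subspace A Z" and Y: "invariant_subspace A Y" and disjoint: "Z \<inter> Y \<subseteq> {0}"
    and D0: "nd_decomposition A Z D0" and D1: "nd_decomposition A Y D1"
  shows "\<exists>D. nd_decomposition A {z + y |z y. z \<in> Z \<and> y \<in> Y} D"
proof -
  have Zsub: "vec.subspace Z" and Ysub: "vec.subspace Y"
    using Z Y by (simp_all add: invariant_subspace_def)
  have lin0: "Vector_Spaces.linear (*s) (*s) D0" and lin1: "Vector_Spaces.linear (*s) (*s) D1"
    and D0Z: "\<forall>x\<in>Z. D0 x \<in> Z" and D1Y: "\<forall>x\<in>Y. D1 x \<in> Y"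
    using D0 D1 by (simp_all add: nd_decomposition_def)
  obtain D where lin: "Vector_Spaces.linear (*s) (*s) D"
    and DZ: "\<forall>x\<in>Z. D x = D0 x" and DY: "\<forall>x\<in>Y. D x = D1 x"
    using linear_glue[OF Zsub Ysub disjoint lin0 lin1] by blast
  have NZ: "nil_part A D z = nil_part A D0 z" "nil_part A D0 z \<in> Z" if "z \<in> Z" for z
    using that DZ D0Z Z Zsub
    by (auto simp: nil_part_def invariant_subspace_def intro: vec.subspace_diff)
  have NY: "nil_part A D y = nil_part A D1 y" "nil_part A D1 y \<in> Y" if "y \<in> Y" for y
    using that DY D1Y Y Ysub
    by (auto simp: nil_part_def invariant_subspace_def intro: vec.subspace_diff)
  have "nd_decomposition A {z + y |z y. z \<in> Z \<and> y \<in> Y} D"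
    unfolding nd_decomposition_def
  proof (intro conjI ballI lin)
    fix x assume "x \<in> {z + y |z y. z \<in> Z \<and> y \<in> Y}"
    then obtain z y where zy: "z \<in> Z" "y \<in> Y" "x = z + y" by blast
    have "D x = D0 z + D1 y" using zy DZ DY vec.linear_add[OF lin] by simp
    then show "D x \<in> {z + y |z y. z \<in> Z \<and> y \<in> Y}" using zy D0Z D1Y by blast
    have "poly_map D (vanishing_poly UNIV) x
        = poly_map D0 (vanishing_poly UNIV) z + poly_map D1 (vanishing_poly UNIV) y"
      using zy poly_map_local[OF DZ D0Z zy(1)] poly_map_local[OF DY D1Y zy(2)]
      by (simp add: vec.linear_add[OF linear_poly_map[OF lin]])
    then show "poly_map D (vanishing_poly UNIV) x = 0"
      using D0 D1 zy by (simp add: nd_decomposition_def)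
    have "nil_part A D (nil_part A D x)
        = nil_part A D0 (nil_part A D0 z) + nil_part A D1 (nil_part A D1 y)"
      using zy NZ[OF zy(1)] NZ[OF NZ(2)[OF zy(1)]] NY[OF zy(2)] NY[OF NY(2)[OF zy(2)]]
      by (simp add: vec.linear_add[OF linear_nil_part[OF lin]])
    then show "nil_part A D (nil_part A D x) = 0"
      using D0 D1 zy by (simp add: nd_decomposition_def)
  qed
  then show ?thesis by blast
qed

lemma nd_decomposition_exists:
  fixes A :: "'a::{field,finite}^'n^'n"
  assumes ch: "CHAR('a) = 2" and card: "CARD('a) \<ge> 4"
  shows "invariant_subspace A W \<Longrightarrow> \<exists>D. nd_decomposition A W D"
proof (induction "vec.dim W" arbitrary: W rule: less_induct)
  case less
  have Wsub: "vec.subspace W" using less.prems by (simp add: invariant_subspace_def)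
  show ?case
  proof (cases "\<exists>z\<in>W. z \<noteq> 0")
    case False
    then have "nd_decomposition A W (\<lambda>_. 0)"
      using vec.linear_zero by (auto simp: nd_decomposition_def nil_part_def
          vec.linear_0[OF linear_poly_map[OF vec.linear_zero]])
    then show ?thesis by blast
  next
    case True
    obtain w k W' where w: "w \<in> W" and k: "1 \<le> k" and indep: "krylov_indep A w k"
      and closed: "mpow A k w \<in> cyclic_subspace A w k"
      and W': "invariant_subspace A W'" "W' \<subseteq> W" "w \<notin> W'"
      and disjoint: "cyclic_subspace A w k \<inter> W' \<subseteq> {0}"
      and decomp: "\<forall>x\<in>W. \<exists>z\<in>cyclic_subspace A w k. \<exists>y\<in>W'. x = z + y"
      by (rule cyclic_summand_exists[OF less.prems True])
    have "vec.span W' \<subset> vec.span W"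
      using W' w Wsub by (auto simp: invariant_subspace_def vec.span_eq_iff[THEN iffD2])
    then have "vec.dim W' < vec.dim W" by (rule vec.dim_psubset)
    then obtain D1 where "nd_decomposition A W' D1" using less.hyps W'(1) by blast
    moreover obtain D0 where "nd_decomposition A (cyclic_subspace A w k) D0"
      using nd_decomposition_cyclic[OF ch card k indep closed] by blast
    ultimately obtain D
      where D: "nd_decomposition A {z + y |z y. z \<in> cyclic_subspace A w k \<and> y \<in> W'} D"
      using nd_decomposition_direct_sum[OF invariant_cyclic_subspace[OF closed] W'(1) disjoint]
      by blast
    have "{z + y |z y. z \<in> cyclic_subspace A w k \<and> y \<in> W'} = W"
    proof
      show "{z + y |z y. z \<in> cyclic_subspace A w k \<and> y \<in> W'} \<subseteq> W"
        using cyclic_subspace_subset[OF less.prems w] W'(2)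
        by (auto intro!: vec.subspace_add[OF Wsub])
      show "W \<subseteq> {z + y |z y. z \<in> cyclic_subspace A w k \<and> y \<in> W'}"
        using decomp by blast
    qed
    then show ?thesis using D by auto
  qed
qed

section \<open>Diagonalizability\<close>

text \<open>With \<open>Q = vanishing_poly S\<close> and \<open>\<mu> \<notin> S\<close>, the polynomial \<open>1 - Q / Q(\<mu>)\<close> is divisible by
  \<open>X - \<mu>\<close>; this splits off from \<open>x\<close> the eigenvector \<open>Q(f) x / Q(\<mu>)\<close> for \<open>\<mu>\<close>.\<close>

lemma vanishing_poly_eigenvector_span:
  fixes f :: "'a::field^'n \<Rightarrow> 'a^'n"
  assumes lin: "Vector_Spaces.linear (*s) (*s) f" and fin: "finite S"
  shows "poly_map f (vanishing_poly S) x = 0 \<Longrightarrow> x \<in> vec.span {v. \<exists>t. f v = t *s v}"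
  using fin
proof (induction S arbitrary: x rule: finite_induct)
  case empty
  then have "x = 0" by (simp add: vanishing_poly_def poly_map_1)
  then show ?case by (simp add: vec.span_zero)
next
  case (insert \<mu> S)
  let ?E = "{v. \<exists>t. f v = t *s v}"
  define Q where "Q = vanishing_poly S"
  have Q_insert: "vanishing_poly (insert \<mu> S) = [:- \<mu>, 1:] * Q"
    using insert(1,2) by (simp add: vanishing_poly_def Q_def)
  define c where "c = poly Q \<mu>"
  have c: "c \<noteq> 0"
    unfolding c_def Q_def vanishing_poly_def poly_prod using insert(1,2) by auto
  define y where "y = poly_map f Q x"
  have "f y - \<mu> *s y = poly_map f ([:- \<mu>, 1:] * Q) x"
    unfolding y_def poly_map_mult[OF lin] by (rule poly_map_linear_factor[OF lin, symmetric])
  also have "\<dots> = 0" using insert(4) Q_insert by simp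
  finally have "y \<in> ?E" by auto
  have "poly (1 - smult (1 / c) Q) \<mu> = 0" using c by (simp add: c_def)
  then have "[:- \<mu>, 1:] dvd 1 - smult (1 / c) Q" using dvd_iff_poly_eq_0[of "- \<mu>"] by simp
  then obtain R where R: "1 - smult (1 / c) Q = [:- \<mu>, 1:] * R" by (rule dvdE)
  define x' where "x' = poly_map f (1 - smult (1 / c) Q) x"
  have "poly_map f Q x' = poly_map f R (poly_map f (vanishing_poly (insert \<mu> S)) x)"
    unfolding x'_def R Q_insert poly_map_mult[OF lin, symmetric] by (simp only: ac_simps)
  also have "\<dots> = 0" unfolding insert(4) by (rule vec.linear_0[OF linear_poly_map[OF lin]])
  finally have "x' \<in> vec.span ?E" unfolding Q_def by (rule insert.IH)
  then have "x' + (1 / c) *s y \<in> vec.span ?E"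
    by (rule vec.span_add[OF _ vec.span_scale[OF vec.span_base[OF \<open>y \<in> ?E\<close>]]])
  moreover have "x = x' + (1 / c) *s y"
    by (simp add: x'_def y_def poly_map_diff poly_map_smult poly_map_1)
  ultimately show ?case by simp
qed

lemma matrix_inv_left:
  fixes U :: "'a::field^'n^'n"
  assumes "invertible U"
  shows "matrix_inv U ** U = mat 1"
proof -
  have "\<exists>U'. U ** U' = mat 1 \<and> U' ** U = mat 1" using assms by (simp add: invertible_def)
  then show ?thesis unfolding matrix_inv_def by (rule someI2_ex) blast
qed

lemma diagonalizable_if_eigenbasis:
  fixes M :: "'a::field^'n^'n" and e :: "'n \<Rightarrow> 'a^'n"
  assumes indep: "\<And>c. (\<Sum>i\<in>UNIV. c i *s e i) = 0 \<Longrightarrow> \<forall>i. c i = 0"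
    and eigen: "\<And>j. M *v e j = d j *s e j"
  shows "diagonalizable M"
proof -
  define U :: "'a^'n^'n" where "U = (\<chi> i j. e j $ i)"
  have U_axis: "U *v axis j 1 = e j" for j
    by (simp add: U_def vec_eq_iff matrix_vector_mult_def axis_def if_distrib cong: if_cong)
  have "invertible U"
    unfolding invertible_left_inverse matrix_left_invertible_independent_columns
    using indep by (simp add: column_def U_def vec_eq_iff)
  then have "matrix_inv U ** U = mat 1" by (rule matrix_inv_left)
  then have U_inv: "matrix_inv U *v e j = axis j 1" for j
    by (metis U_axis matrix_vector_mul_assoc matrix_vector_mul_lid)
  have "(matrix_inv U ** M ** U) $ i $ j = 0" if "i \<noteq> j" for i j
  proof -
    have "(matrix_inv U ** M ** U) *v axis j 1 = d j *s axis j 1"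
      by (simp add: matrix_vector_mul_assoc[symmetric] U_axis eigen U_inv
          vec.linear_scale[OF matrix_vector_mul_linear_gen])
    then show ?thesis
      using that by (simp add: vec_eq_iff matrix_vector_mult_def axis_def if_distrib cong: if_cong)
  qed
  then show ?thesis
    using \<open>invertible U\<close> unfolding diagonalizable_def is_diagonal_matrix_def by blast
qed

lemma diagonalizable_if_eigenvectors_span:
  fixes M :: "'a::field^'n^'n"
  assumes span: "vec.span {v. \<exists>t. M *v v = t *s v} = UNIV"
  shows "diagonalizable M"
proof -
  let ?E = "{v. \<exists>t. M *v v = t *s v}"
  obtain B where B: "B \<subseteq> ?E" "vec.independent B" "?E \<subseteq> vec.span B"
    by (rule vec.maximal_independent_subset)
  have "vec.span B = UNIV"
    using vec.span_mono[OF B(3)] span by (auto simp: vec.span_span)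
  then have "card B = CARD('n)"
    using vec.basis_card_eq_dim[of B UNIV] B(2) by (simp add: vec.dim_UNIV card_cart_basis)
  then obtain e where e: "bij_betw e (UNIV :: 'n set) B"
    using finite_same_card_bij[of "UNIV :: 'n set" B] vec.finiteI_independent[OF B(2)] by auto
  have "\<forall>j. \<exists>t. M *v e j = t *s e j"
    using B(1) bij_betwE[OF e] by blast
  then obtain d where d: "\<And>j. M *v e j = d j *s e j" by metis
  have "\<forall>i. c i = 0" if "(\<Sum>i\<in>UNIV. c i *s e i) = 0" for c
  proof -
    have inj: "inj e" and B_eq: "B = range e" using e by (auto simp: bij_betw_def)
    have indep_B: "\<forall>v\<in>B. u v = 0" if "(\<Sum>v\<in>B. u v *s v) = 0" for u
      using B(2) that unfolding vec.independent_explicit by blast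
    have "(\<Sum>v\<in>B. c (inv_into UNIV e v) *s v) = 0"
      using that unfolding B_eq by (simp add: sum.reindex[OF inj] inj)
    then have "\<forall>v\<in>B. c (inv_into UNIV e v) = 0" by (rule indep_B)
    then show ?thesis using inj by (simp add: B_eq)
  qed
  then show ?thesis using d by (rule diagonalizable_if_eigenbasis)
qed

theorem theorem3p1:
  fixes A :: "'a::{field,finite} ^'n::finite^'n"
  assumes "CHAR('a) = 2"
    and "CARD('a) \<ge> 4"
  shows "\<exists>N D :: 'a^'n^'n. A = N + D \<and> N ** N = 0 \<and> diagonalizable D"
proof -
  have "\<exists>D. nd_decomposition A UNIV D"
    by (rule nd_decomposition_exists[OF assms]) (simp add: invariant_subspace_def)
  then obtain D where D: "nd_decomposition A UNIV D" ..
  then have lin: "Vector_Spaces.linear (*s) (*s) D" by (simp add: nd_decomposition_def)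
  define M where "M = matrix D"
  have M: "(*v) M = D" using matrix_works[OF lin] by (auto simp: M_def)
  have "(A - M) *v ((A - M) *v x) = 0" for x
    using D by (simp add: nd_decomposition_def nil_part_def M matrix_vector_mult_diff_rdistrib)
  then have "(A - M) ** (A - M) = 0"
    by (simp add: matrix_eq matrix_vector_mul_assoc[symmetric])
  moreover have "diagonalizable M"
    using D vanishing_poly_eigenvector_span[OF lin]
    by (intro diagonalizable_if_eigenvectors_span) (auto simp: nd_decomposition_def M)
  ultimately show ?thesis by (intro exI[of _ "A - M"] exI[of _ M]) simp
qed

end
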